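(* Let $G$ be a connected graph and $\mathcal{P}$ a set of robust regular bounded profiles in $G$. Then there is a nested set $N$ of separations of $G$ which efficiently distinguishes all distinguishable profiles in $\mathcal{P}$, i.e. for any two distinguishable $P,P'\in\mathcal{P}$ some element of $N$ efficiently distinguishes $P$ and $P'$.
   Context: A separation of a graph $G=(V,E)$ is a pair $(A,B)$ with $A\cup B=V$ and no edge between $A\smallsetminus B$ and $B\smallsetminus A$; its separator is $A\cap B$ and its order is $|A\cap B|$ (when finite). Its inverse is $(B,A)$; the unoriented separation is $\{A,B\}$. $(A,B)\le(C,D)$ iff $A\subseteq C$ and $B\supseteq D$; join $(A,B)\lor(C,D)=(A\cup C,B\cap D)$. Two separations are nested if suitable orientations of them are comparable under $\le$; a set is nested if its elements are pairwise nested. For $k\in\mathbb{N}\cup\{\aleph_0\}$, a $k$-profile is a set $P$ of separations of order $<k$ containing exactly one of $(A,B),(B,A)$ for each separation of order $<k$, which is consistent (no $(A,B),(C,D)\in P$ with $\{A,B\}\neq\{C,D\}$ and $(B,A)\le(C,D)$) and satisfies $(B\cap D,A\cup C)\notin P$ for all $(A,B),(C,D)\in P$. $P$ is robust if for all $(A,B)\in P$ and every separation $(C,D)$ of finite order: if $|(A,B)\lor(C,D)|<|A\cap B|$ and $|(A,B)\lor(D,C)|<|A\cap B|$ then one of these two joins lies in $P$. $P$ is regular if it contains no separation $(V,X)$. $P$ is bounded if it is a $k$-profile for some $k\in\mathbb{N}$ but is not a subset of any $\aleph_0$-profile. A separation $\{A,B\}$ distinguishes $P,P'$ if $(A,B)\in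 P$, $(B,A)\in P'$ or vice versa, efficiently if its order is minimal among all distinguishing separations; $P,P'$ are distinguishable if some separation distinguishes them. *)

theory Defs
  imports Main "HOL-Library.Extended_Nat"
begin

text \<open>Graphs are simple and undirected, possibly infinite: a vertex set \<open>V\<close> and a set \<open>E\<close> of
  two-element subsets of \<open>V\<close>.\<close>

definition simple_graph :: "'a set \<Rightarrow> 'a set set \<Rightarrow> bool" where
  "simple_graph V E \<longleftrightarrow> (\<forall>e\<in>E. \<exists>u\<in>V. \<exists>v\<in>V. u \<noteq> v \<and> e = {u, v})"

definition connected_graph :: "'a set \<Rightarrow> 'a set set \<Rightarrow> bool" where
  "connected_graph V E \<longleftrightarrow>
     simple_graph V E \<and> (\<forall>u\<in>V. \<forall>v\<in>V. (u, v) \<in> {(x, y). {x, y} \<in> E}\<^sup>*)"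

type_synonym 'a osep = "'a set \<times> 'a set"

fun separation :: "'a set \<Rightarrow> 'a set set \<Rightarrow> 'a osep \<Rightarrow> bool" where
  "separation V E (A, B) \<longleftrightarrow> A \<union> B = V \<and> (\<forall>x\<in>A - B. \<forall>y\<in>B - A. {x, y} \<notin> E)"

text \<open>The value \<open>\<infinity>\<close> stands for any infinite order.\<close>

fun sep_order :: "'a osep \<Rightarrow> enat" where
  "sep_order (A, B) = (if finite (A \<inter> B) then enat (card (A \<inter> B)) else \<infinity>)"

fun sep_le :: "'a osep \<Rightarrow> 'a osep \<Rightarrow> bool" where
  "sep_le (A, B) (C, D) \<longleftrightarrow> A \<subseteq> C \<and> D \<subseteq> B"

fun sep_join :: "'a osep \<Rightarrow> 'a osep \<Rightarrow> 'a osep" where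
  "sep_join (A, B) (C, D) = (A \<union> C, B \<inter> D)"

text \<open>An unoriented separation is the set \<open>{A, B}\<close>; its orientations are \<open>(A, B)\<close> and \<open>(B, A)\<close>.\<close>

type_synonym 'a usep = "'a set set"

definition unoriented_separations :: "'a set \<Rightarrow> 'a set set \<Rightarrow> 'a usep set" where
  "unoriented_separations V E = {{A, B} | A B. separation V E (A, B)}"

definition nested :: "'a usep \<Rightarrow> 'a usep \<Rightarrow> bool" where
  "nested r s \<longleftrightarrow> (\<exists>A B C D. r = {A, B} \<and> s = {C, D} \<and> sep_le (A, B) (C, D))"

definition nested_set :: "'a usep set \<Rightarrow> bool" where
  "nested_set N \<longleftrightarrow> (\<forall>r\<in>N. \<forall>s\<in>N. nested r s)"

text \<open>The index \<open>k = \<infinity>\<close> plays the role of \<open>\<aleph>\<^sub>0\<close>. Unique existence over the set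
  \<open>{(A, B), (B, A)}\<close> also makes sense for the degenerate separation \<open>(V, V)\<close>, whose two orientations
  coincide.\<close>

definition profile :: "'a set \<Rightarrow> 'a set set \<Rightarrow> enat \<Rightarrow> 'a osep set \<Rightarrow> bool" where
  "profile V E k P \<longleftrightarrow>
     (\<forall>s\<in>P. separation V E s \<and> sep_order s < k) \<and>
     (\<forall>A B. separation V E (A, B) \<and> sep_order (A, B) < k \<longrightarrow>
        (\<exists>!s. s \<in> {(A, B), (B, A)} \<and> s \<in> P)) \<and>
     (\<forall>A B C D. (A, B) \<in> P \<and> (C, D) \<in> P \<and> {A, B} \<noteq> {C, D} \<longrightarrow> \<not> sep_le (B, A) (C, D)) \<and>
     (\<forall>A B C D. (A, B) \<in> P \<and> (C, D) \<in> P \<longrightarrow> (B \<inter> D, A \<union> C) \<notin> P)"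

definition robust :: "'a set \<Rightarrow> 'a set set \<Rightarrow> 'a osep set \<Rightarrow> bool" where
  "robust V E P \<longleftrightarrow>
     (\<forall>A B C D. (A, B) \<in> P \<and> separation V E (C, D) \<and> sep_order (C, D) < \<infinity> \<and>
        sep_order (sep_join (A, B) (C, D)) < sep_order (A, B) \<and>
        sep_order (sep_join (A, B) (D, C)) < sep_order (A, B) \<longrightarrow>
        sep_join (A, B) (C, D) \<in> P \<or> sep_join (A, B) (D, C) \<in> P)"

definition regular :: "'a set \<Rightarrow> 'a osep set \<Rightarrow> bool" where
  "regular V P \<longleftrightarrow> (\<forall>X. (V, X) \<notin> P)"

definition bounded_profile :: "'a set \<Rightarrow> 'a set set \<Rightarrow> 'a osep set \<Rightarrow> bool" where
  "bounded_profile V E P \<longleftrightarrow>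
     (\<exists>k::nat. profile V E (enat k) P) \<and> \<not> (\<exists>Q. profile V E \<infinity> Q \<and> P \<subseteq> Q)"

definition distinguishes ::
    "'a set \<Rightarrow> 'a set set \<Rightarrow> 'a osep \<Rightarrow> 'a osep set \<Rightarrow> 'a osep set \<Rightarrow> bool" where
  "distinguishes V E s P P' \<longleftrightarrow>
     separation V E s \<and>
     (s \<in> P \<and> prod.swap s \<in> P' \<or> prod.swap s \<in> P \<and> s \<in> P')"

definition distinguishable ::
    "'a set \<Rightarrow> 'a set set \<Rightarrow> 'a osep set \<Rightarrow> 'a osep set \<Rightarrow> bool" where
  "distinguishable V E P P' \<longleftrightarrow> (\<exists>s. distinguishes V E s P P')"

text \<open>Both \<open>distinguishes\<close> and \<open>sep_order\<close> are invariant under inversion, so the choice of the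
  orientation \<open>(A, B)\<close> of the unoriented separation is immaterial.\<close>

definition efficiently_distinguishes ::
    "'a set \<Rightarrow> 'a set set \<Rightarrow> 'a usep \<Rightarrow> 'a osep set \<Rightarrow> 'a osep set \<Rightarrow> bool" where
  "efficiently_distinguishes V E r P P' \<longleftrightarrow>
     (\<exists>A B. r = {A, B} \<and> distinguishes V E (A, B) P P' \<and>
        (\<forall>s. distinguishes V E s P P' \<longrightarrow> sep_order (A, B) \<le> sep_order s))"

end

theory Submission
  imports Defs
begin

text \<open>
  We first work with separators instead of separations. Since the profiles are bounded and regular,
  each profile selects a component of \<open>G - X\<close> for every separator \<open>X\<close> it orients, and the separator of
  an efficient distinguisher is \<^emph>\<open>tight\<close>: the components selected by the two profiles both have all of \<open>X\<close>
  as neighbourhood. A tight separator crosses only finitely many others of bounded size. When two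
  efficient separators cross, submodularity (together with robustness if their sizes differ) yields a
  corner that is again efficient and crosses fewer separators. Choosing, size by size, separators with
  minimal crossing numbers therefore produces a non-crossing system of separators. Finally each of
  these separators \<open>X\<close> is turned into the separations \<open>{V - C, C \<union> X}\<close> for all but one of the components
  \<open>C\<close> with neighbourhood \<open>X\<close>; the omitted components are chosen coherently by a well-ordering of the vertices.
\<close>

text \<open>Crossing numbers must be finite, and for separations they can fail to be: if
  \<open>G - X\<close> has infinitely many components, distributing them over the two sides in
  different ways gives infinitely many crossing separations with the same separator. Counting
  separators removes this multiplicity, at the price of recovering separations at the end. That
  loses no pair of profiles: if \<open>X\<close> is the separator of an efficient distinguisher of
  \<open>P\<close> and \<open>P'\<close>, then the components selected by \<open>P\<close> and by
  \<open>P'\<close> are distinct, and cutting off either of them distinguishes \<open>P\<close> from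
  \<open>P'\<close> with the same order, so one component per separator may be omitted. Boundedness
  is what supplies a component to cut off, since otherwise a profile may point to infinitely many
  components jointly without choosing one. Regularity acts through joins: two members of a profile
  whose first sides cover \<open>V\<close> cannot have a join of small order, because that join
  would be some \<open>(V, Y)\<close> in the profile.\<close>

section \<open>The thin splinter lemma\<close>

text \<open>A greedy choice by increasing size: \<open>M k\<close> holds the chosen elements, all of
  size below \<open>k\<close>. The hypothesis \<open>less\<close> guarantees that every set of
  elements of size \<open>k\<close> still has one crossing nothing in \<open>M k\<close>, and
  \<open>equal\<close> that the candidates minimising \<open>cr\<close> do not cross each other.
  Hence \<open>cr\<close> counts crossings within one size only.\<close>

lemma thin_splinter:
  fixes \<A> :: "'x set set" and sz :: "'x \<Rightarrow> nat" and cross :: "'x \<Rightarrow> 'x \<Rightarrow> bool"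
  defines "cr \<equiv> \<lambda>x. card {y \<in> \<Union>\<A>. sz y = sz x \<and> cross x y}"
  assumes sym: "\<And>x y. cross x y \<Longrightarrow> cross y x"
    and nonempty: "\<And>A. A \<in> \<A> \<Longrightarrow> A \<noteq> {}"
    and same: "\<And>A x y. A \<in> \<A> \<Longrightarrow> x \<in> A \<Longrightarrow> y \<in> A \<Longrightarrow> sz x = sz y"
    and fin: "\<And>x. x \<in> \<Union>\<A> \<Longrightarrow> finite {y \<in> \<Union>\<A>. sz y \<le> sz x \<and> cross x y}"
    and less: "\<And>A B a b. A \<in> \<A> \<Longrightarrow> B \<in> \<A> \<Longrightarrow> a \<in> A \<Longrightarrow> b \<in> B \<Longrightarrow> sz a < sz b \<Longrightarrow> cross a b \<Longrightarrow>
      \<exists>c\<in>B. \<not> cross c a \<and> (\<forall>s\<in>\<Union>\<A>. \<not> cross s a \<and> \<not> cross s b \<longrightarrow> \<not> cross s c)"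
    and equal: "\<And>A B a b. A \<in> \<A> \<Longrightarrow> B \<in> \<A> \<Longrightarrow> a \<in> A \<Longrightarrow> b \<in> B \<Longrightarrow> sz a = sz b \<Longrightarrow> cross a b \<Longrightarrow>
      \<exists>c. (c \<in> A \<and> cr c < cr a \<or> c \<in> B \<and> cr c < cr b) \<and>
        (\<forall>s\<in>\<Union>\<A>. \<not> cross s a \<and> \<not> cross s b \<longrightarrow> \<not> cross s c)"
  shows "\<exists>N\<subseteq>\<Union>\<A>. (\<forall>x\<in>N. \<forall>y\<in>N. \<not> cross x y) \<and> (\<forall>A\<in>\<A>. A \<inter> N \<noteq> {})"
proof -
  define free where "free M x \<longleftrightarrow> (\<forall>y\<in>M. \<not> cross x y)" for M x
  \<comment> \<open>Minimality is asked only within one \<open>A\<close> and among its free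
    elements. A corner supplied by \<open>equal\<close> crosses no element of \<open>M k\<close>, so
    it is free itself and would beat the minimum.\<close>
  define new where "new M k = {x. sz x = k \<and> free M x \<and>
    (\<exists>A\<in>\<A>. x \<in> A \<and> (\<forall>z\<in>A. free M z \<longrightarrow> cr x \<le> cr z))}" for M k
  define M where "M = rec_nat {} (\<lambda>k S. S \<union> new S k)"
  have M0: "M 0 = {}" and MS: "\<And>k. M (Suc k) = M k \<union> new (M k) k"
    by (simp_all add: M_def)
  have inv: "M k \<subseteq> \<Union>\<A> \<and> (\<forall>x\<in>M k. sz x < k) \<and> (\<forall>x\<in>M k. free (M k) x)" for k
  proof (induction k)
    case 0
    show ?case by (simp add: M0)
  next
    case (Suc k)
    have "\<not> cross x y" if xy: "x \<in> new (M k) k" "y \<in> new (M k) k" for x y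
    proof
      assume c: "cross x y"
      have sz: "sz x = sz y" and fr: "free (M k) x" "free (M k) y"
        using xy by (simp_all add: new_def)
      from xy obtain A B where AB: "A \<in> \<A>" "x \<in> A" "B \<in> \<A>" "y \<in> B"
        and minx: "\<forall>z\<in>A. free (M k) z \<longrightarrow> cr x \<le> cr z"
        and miny: "\<forall>z\<in>B. free (M k) z \<longrightarrow> cr y \<le> cr z"
        unfolding new_def by blast
      obtain c where c: "c \<in> A \<and> cr c < cr x \<or> c \<in> B \<and> cr c < cr y"
        and corner: "\<forall>s\<in>\<Union>\<A>. \<not> cross s x \<and> \<not> cross s y \<longrightarrow> \<not> cross s c"
        using equal[OF AB(1,3,2,4) sz c] by blast
      have "\<not> cross c s" if s: "s \<in> M k" for s
        using fr corner s Suc.IH sym[of s x] sym[of s y] sym[of c s] unfolding free_def by blast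
      then have "free (M k) c" by (simp add: free_def)
      then have "c \<in> A \<Longrightarrow> cr x \<le> cr c" "c \<in> B \<Longrightarrow> cr y \<le> cr c"
        using minx miny by simp_all
      then show False using c by linarith
    qed
    moreover have "\<not> cross x y \<and> \<not> cross y x" if "x \<in> new (M k) k" "y \<in> M k" for x y
      using that sym[of y x] by (auto simp: new_def free_def)
    moreover have "sz x = k" "x \<in> \<Union>\<A>" if "x \<in> new (M k) k" for x
      using that by (auto simp: new_def)
    ultimately show ?case
      using Suc.IH unfolding MS free_def by (auto simp: less_Suc_eq)
  qed
  \<comment> \<open>The witness is an element of \<open>A\<close> crossing as few members of
    \<open>M k\<close> as possible; a remaining crossing with some \<open>a\<close> could be removed
    by passing to the corner from \<open>less\<close>.\<close>
  have free_ex: "\<exists>x\<in>A. free (M k) x" if A: "A \<in> \<A>" and k: "\<And>x. x \<in> A \<Longrightarrow> sz x = k" for A k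
  proof -
    define n where "n x = card {y \<in> M k. cross x y}" for x
    have "\<exists>x. x \<in> A \<and> (\<forall>z. z \<in> A \<longrightarrow> n x \<le> n z)"
      using nonempty[OF A] ex_has_least_nat[of "\<lambda>x. x \<in> A" _ n] by blast
    then obtain b where b: "b \<in> A" and least: "\<And>z. z \<in> A \<Longrightarrow> n b \<le> n z" by blast
    have "free (M k) b"
    proof (rule ccontr)
      assume "\<not> free (M k) b"
      then obtain a where a: "a \<in> M k" "cross b a" by (auto simp: free_def)
      then obtain B where B: "B \<in> \<A>" "a \<in> B" using inv by blast
      have "sz a < sz b" using a inv b k by auto
      from less[OF B(1) A B(2) b this sym[OF a(2)]] obtain c where c: "c \<in> A" "\<not> cross c a"
        and corner: "\<forall>s\<in>\<Union>\<A>. \<not> cross s a \<and> \<not> cross s b \<longrightarrow> \<not> cross s c" by blast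
      \<comment> \<open>Members of \<open>M k\<close> do not cross \<open>a\<close>, so one that
        crosses the corner \<open>c\<close> must already cross \<open>b\<close>. The inclusion is
        strict because \<open>a\<close> crosses \<open>b\<close> but not \<open>c\<close>.\<close>
      have "cross b y" if y: "y \<in> M k" "cross c y" for y
        using y corner inv[of k] a(1) sym[of c y] sym[of y b] unfolding free_def by blast
      then have "{y \<in> M k. cross c y} \<subset> {y \<in> M k. cross b y}"
        using a c(2) by blast
      moreover have "finite {y \<in> M k. cross b y}"
      proof (rule finite_subset[OF _ fin[of b]])
        show "{y \<in> M k. cross b y} \<subseteq> {y \<in> \<Union>\<A>. sz y \<le> sz b \<and> cross b y}"
          using inv[of k] b k by (auto dest: less_imp_le)
      qed (use A b in blast)
      ultimately have "n c < n b" unfolding n_def by (rule psubset_card_mono[rotated])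
      then show False using least[OF c(1)] by simp
    qed
    with b show ?thesis by blast
  qed
  have meet: "\<exists>k. A \<inter> M k \<noteq> {}" if A: "A \<in> \<A>" for A
  proof -
    obtain k where k: "\<And>x. x \<in> A \<Longrightarrow> sz x = k" using same[OF A] by blast
    obtain x where "x \<in> A \<and> free (M k) x" using free_ex[OF A k] by blast
    from ex_has_least_nat[of "\<lambda>x. x \<in> A \<and> free (M k) x" x cr, OF this]
    obtain x where "x \<in> A" "free (M k) x" "\<forall>z. z \<in> A \<and> free (M k) z \<longrightarrow> cr x \<le> cr z" by blast
    then have "x \<in> new (M k) k" using A k by (auto simp: new_def)
    then show ?thesis using \<open>x \<in> A\<close> MS[of k] by blast
  qed
  have mono: "M i \<subseteq> M j" if "i \<le> j" for i j
    using that by (rule lift_Suc_mono_le[rotated]) (simp add: MS)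
  have "\<not> cross x y" if xy: "x \<in> (\<Union>k. M k)" "y \<in> (\<Union>k. M k)" for x y
  proof -
    obtain i j where "x \<in> M i" "y \<in> M j" using xy by blast
    then have "x \<in> M (max i j)" "y \<in> M (max i j)" using mono[of i "max i j"] mono[of j "max i j"] by auto
    then show ?thesis using inv unfolding free_def by blast
  qed
  then show ?thesis
  proof (intro exI[of _ "\<Union>k. M k"] conjI ballI)
    show "(\<Union>k. M k) \<subseteq> \<Union>\<A>" using inv by blast
    show "A \<inter> (\<Union>k. M k) \<noteq> {}" if "A \<in> \<A>" for A using meet[OF that] by blast
  qed
qed

section \<open>Components and separators\<close>

locale graph_separations =
  fixes V :: "'a set" and E :: "'a set set"
  assumes simple: "simple_graph V E"
begin

definition adj :: "'a set \<Rightarrow> ('a \<times> 'a) set" where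
  "adj X = {(u, v). {u, v} \<in> E \<and> u \<notin> X \<and> v \<notin> X}"

text \<open>By reflexivity this is \<open>{u}\<close> when \<open>u\<close> lies in
  \<open>X\<close>; it is a component of \<open>G - X\<close> only for \<open>u\<close> in
  \<open>V - X\<close>, hence the guards in \<open>full\<close> and
  \<open>separates\<close>.\<close>

definition component :: "'a set \<Rightarrow> 'a \<Rightarrow> 'a set" where
  "component X u = {v. (u, v) \<in> (adj X)\<^sup>*}"

definition full :: "'a set \<Rightarrow> 'a set \<Rightarrow> bool" where
  "full X C \<longleftrightarrow> (\<exists>u\<in>V - X. C = component X u) \<and> (\<forall>x\<in>X. \<exists>c\<in>C. {x, c} \<in> E)"

definition tight :: "'a set \<Rightarrow> bool" where
  "tight X \<longleftrightarrow> X \<subseteq> V \<and> finite X \<and> (\<exists>C D. full X C \<and> full X D \<and> C \<inter> D = {})"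

definition separates :: "'a set \<Rightarrow> 'a set \<Rightarrow> bool" where
  "separates X Y \<longleftrightarrow> (\<exists>u\<in>Y - X. \<exists>v\<in>Y - X. v \<notin> component X u)"

text \<open>Symmetric by definition, as \<open>thin_splinter\<close> requires. Between tight
  separators each disjunct implies the other, see \<open>cross_iff\<close>.\<close>

definition cross :: "'a set \<Rightarrow> 'a set \<Rightarrow> bool" where
  "cross X Y \<longleftrightarrow> separates X Y \<or> separates Y X"

lemma edge_in_V: "{u, v} \<in> E \<Longrightarrow> u \<in> V \<and> v \<in> V"
  using simple unfolding simple_graph_def by (metis doubleton_eq_iff)

lemma component_refl [simp]: "u \<in> component X u"
  by (simp add: component_def)

lemma component_sym: "v \<in> component X u \<Longrightarrow> u \<in> component X v"
proof -
  have "sym (adj X)" by (auto simp: sym_def adj_def insert_commute)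
  then show "v \<in> component X u \<Longrightarrow> u \<in> component X v"
    by (auto simp: component_def dest: sym_rtrancl symD)
qed

lemma component_trans: "v \<in> component X u \<Longrightarrow> w \<in> component X v \<Longrightarrow> w \<in> component X u"
  by (auto simp: component_def)

lemma component_eq: "v \<in> component X u \<Longrightarrow> component X v = component X u"
  using component_trans[of _ X _ _] component_sym[of v X u] by auto

lemma component_induct [consumes 1, case_names refl step]:
  assumes "v \<in> component X u" and "Q u"
    and "\<And>v w. v \<in> component X u \<Longrightarrow> Q v \<Longrightarrow> {v, w} \<in> E \<Longrightarrow> v \<notin> X \<Longrightarrow> w \<notin> X \<Longrightarrow> w \<in> component X u \<Longrightarrow> Q w"
  shows "Q v"
proof -
  have "(u, v) \<in> (adj X)\<^sup>*" using assms(1) by (simp add: component_def)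
  then show ?thesis
  proof (induction rule: rtrancl_induct)
    case base then show ?case by (rule assms(2))
  next
    case (step y z)
    then have "(u, z) \<in> (adj X)\<^sup>*" by auto
    with step assms(3)[of y z] show ?case by (auto simp: component_def adj_def)
  qed
qed

lemma component_step:
  "v \<in> component X u \<Longrightarrow> {v, w} \<in> E \<Longrightarrow> v \<notin> X \<Longrightarrow> w \<notin> X \<Longrightarrow> w \<in> component X u"
  by (auto simp: component_def adj_def intro: rtrancl_into_rtrancl)

lemma component_notin: "v \<in> component X u \<Longrightarrow> u \<notin> X \<Longrightarrow> v \<notin> X"
  by (induction rule: component_induct) auto

lemma component_subset_V: "u \<in> V \<Longrightarrow> component X u \<subseteq> V"
proof
  fix v assume "v \<in> component X u" "u \<in> V"
  then show "v \<in> V" by (induction rule: component_induct) (auto dest: edge_in_V)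
qed

lemma component_avoid:
  assumes "component X u \<inter> Y = {}" shows "component X u \<subseteq> component Y u"
proof
  fix v assume "v \<in> component X u"
  then show "v \<in> component Y u"
  proof (induction rule: component_induct)
    case (step v w)
    then show ?case using assms component_step[of v Y u w] by blast
  qed simp
qed

lemma component_side:
  assumes "separation V E (A, B)" "u \<in> A - B"
  shows "component (A \<inter> B) u \<subseteq> A - B"
proof
  fix v assume "v \<in> component (A \<inter> B) u"
  then show "v \<in> A - B"
  proof (induction rule: component_induct)
    case (step v w)
    then have "w \<in> A \<union> B" using edge_in_V assms(1) by auto
    with step assms(1) show ?case by auto
  qed (use assms in auto)
qed

section \<open>Full components and crossing separators\<close>

lemma fullD:
  assumes "full X C"
  shows "C \<subseteq> V" "C \<inter> X = {}" "C \<noteq> {}" "\<And>c. c \<in> C \<Longrightarrow> C = component X c"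
    "\<And>x. x \<in> X \<Longrightarrow> \<exists>c\<in>C. {x, c} \<in> E"
proof -
  from assms obtain u where u: "u \<in> V - X" "C = component X u" unfolding full_def by blast
  show "C \<subseteq> V" using u component_subset_V[of u X] by simp
  show "C \<inter> X = {}" using u component_notin[of _ X u] by auto
  show "C \<noteq> {}" using u(2) component_refl[of u X] by blast
  show "C = component X c" if "c \<in> C" for c
    using component_eq[of c X u] that u(2) by simp
  show "\<exists>c\<in>C. {x, c} \<in> E" if "x \<in> X" for x using that assms by (auto simp: full_def)
qed

lemma full_disjoint: "full X C \<Longrightarrow> full X D \<Longrightarrow> C \<noteq> D \<Longrightarrow> C \<inter> D = {}"
  by (metis disjoint_iff fullD(4))

text \<open>\<open>C\<close> stays connected in \<open>G - Y\<close>, and every vertex of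
  \<open>X\<close> has a neighbour in \<open>C\<close>. So a full component that avoids
  \<open>Y\<close> ties all of \<open>X - Y\<close> into a single component of
  \<open>G - Y\<close>.\<close>

lemma full_attach:
  assumes "full X C" "C \<inter> Y = {}" "x \<in> X - Y" "c \<in> C"
  shows "x \<in> component Y c"
proof -
  obtain d where d: "d \<in> C" "{d, x} \<in> E"
    using fullD(5)[OF assms(1), of x] assms(3) insert_commute[of x _ "{}"] by auto
  have "C \<subseteq> component Y c"
    using component_avoid[of X c Y] fullD(4)[OF assms(1,4)] assms(2) by simp
  then have "d \<in> component Y c" using d(1) by blast
  moreover have "d \<notin> Y" "x \<notin> Y" using d(1) assms(2,3) by auto
  ultimately show ?thesis using component_step[of d Y c x] d(2) by simp
qed

lemma full_avoid_not_separates: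
  assumes "full X C" "C \<inter> Y = {}"
  shows "\<not> separates Y X"
proof -
  obtain c where c: "c \<in> C" using fullD(3)[OF assms(1)] by blast
  have "component Y x = component Y c" if "x \<in> X - Y" for x
    using component_eq[OF full_attach[OF assms that c]] .
  then have "y \<in> component Y x" if "x \<in> X - Y" "y \<in> X - Y" for x y
    using component_refl[of y Y] that by metis
  then show ?thesis unfolding separates_def by blast
qed

lemma not_separates_full_avoid:
  assumes "\<not> separates X Y" "full X C" "full X D" "C \<inter> D = {}"
  shows "C \<inter> Y = {} \<or> D \<inter> Y = {}"
proof (rule ccontr)
  assume "\<not> ?thesis"
  then obtain c d where cd: "c \<in> C \<inter> Y" "d \<in> D \<inter> Y" by blast
  then have "c \<in> Y - X" "d \<in> Y - X"
    using fullD(2)[OF assms(2)] fullD(2)[OF assms(3)] by auto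
  then have "d \<in> component X c"
    using assms(1) unfolding separates_def by blast
  moreover have "component X c = C" using fullD(4)[OF assms(2), of c] cd by simp
  ultimately show False using cd assms(4) by blast
qed

lemma separates_sym:
  assumes "tight X" "separates Y X"
  shows "separates X Y"
proof (rule ccontr)
  assume n: "\<not> separates X Y"
  obtain C D where CD: "full X C" "full X D" "C \<inter> D = {}" using assms(1) unfolding tight_def by blast
  show False
    using not_separates_full_avoid[OF n CD] full_avoid_not_separates[OF CD(1), of Y]
      full_avoid_not_separates[OF CD(2), of Y] assms(2) by blast
qed

lemma cross_iff: "tight X \<Longrightarrow> tight Y \<Longrightarrow> cross X Y \<longleftrightarrow> separates X Y"
  using separates_sym[of X Y] separates_sym[of Y X] unfolding cross_def by blast

lemma cross_sym: "cross X Y \<Longrightarrow> cross Y X"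
  by (auto simp: cross_def)

lemma cross_full_meets: "tight X \<Longrightarrow> tight Y \<Longrightarrow> cross X Y \<Longrightarrow> full Y C \<Longrightarrow> C \<inter> X \<noteq> {}"
  using cross_iff[of X Y] full_avoid_not_separates[of Y C X] by blast

text \<open>Some full component \<open>J\<close> of \<open>G - X\<close> avoids \<open>S\<close>,
  because \<open>S\<close> does not cross \<open>X\<close>, and meets \<open>Y\<close>, because
  \<open>Y\<close> does. In \<open>G - S\<close> the set \<open>X - S\<close> is attached to
  \<open>J\<close>, and \<open>Y - S\<close> lies in one component, which contains a vertex of
  \<open>J\<close>. So all of \<open>(X \<union> Y) - S\<close> lies in one component of
  \<open>G - S\<close>.\<close>

lemma corner_not_cross:
  assumes t: "tight X" "tight Y" "tight S" "tight Z" and cr: "cross X Y"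
    and n: "\<not> cross S X" "\<not> cross S Y" and Z: "Z \<subseteq> X \<union> Y"
  shows "\<not> cross S Z"
proof -
  obtain C D where CD: "full X C" "full X D" "C \<inter> D = {}" using t(1) unfolding tight_def by blast
  obtain J where J: "full X J" "J \<inter> S = {}"
    using not_separates_full_avoid[of X S C D] n CD unfolding cross_def by blast
  obtain y where y: "y \<in> J \<inter> Y" using cross_full_meets[OF t(2,1) cross_sym[OF cr] J(1)] by blast
  have "z \<in> component S y" if "z \<in> Z - S" for z
  proof (cases "z \<in> X")
    case True
    then show ?thesis using full_attach[OF J, of z y] that y by blast
  next
    case False
    then have "z \<in> Y - S" "y \<in> Y - S" using that Z y J(2) by auto
    then show ?thesis using n(2) unfolding cross_def separates_def by blast
  qed
  then have "component S z = component S y" if "z \<in> Z - S" for z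
    using component_eq[of z S y] that by simp
  then have "v \<in> component S u" if "u \<in> Z - S" "v \<in> Z - S" for u v
    using component_refl[of v S] that by metis
  then have "\<not> separates S Z" unfolding separates_def by blast
  then show ?thesis using cross_iff[OF t(3,4)] by blast
qed

lemma not_cross_side:
  assumes "separation V E (A, B)" "\<not> cross (A \<inter> B) S" "S \<subseteq> V"
  shows "S \<subseteq> A \<or> S \<subseteq> B"
proof (rule ccontr)
  assume "\<not> ?thesis"
  then obtain u v where uv: "u \<in> S" "u \<notin> A" "v \<in> S" "v \<notin> B" by blast
  with assms(1,3) have "v \<in> A - B" by auto
  moreover have "u \<in> component (A \<inter> B) v"
    using assms(2) uv unfolding cross_def separates_def by blast
  ultimately show False using component_side[OF assms(1), of v] uv by blast
qed

text \<open>Minimal separators \<open>Y\<close> of \<open>u\<close> and \<open>v\<close> in \<open>G - F\<close>. There are only finitely many of each size because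
  each of them meets a fixed path from \<open>u\<close> to \<open>v\<close>; in that induction \<open>F\<close> collects the deleted vertices.\<close>

definition minsep :: "'a \<Rightarrow> 'a \<Rightarrow> 'a set \<Rightarrow> 'a set \<Rightarrow> bool" where
  "minsep u v F Y \<longleftrightarrow> Y \<inter> F = {} \<and> u \<notin> F \<union> Y \<and> v \<notin> F \<union> Y \<and> v \<notin> component (F \<union> Y) u \<and>
     (\<forall>y\<in>Y. (\<exists>a\<in>component (F \<union> Y) u. {a, y} \<in> E) \<and> (\<exists>b\<in>component (F \<union> Y) v. {b, y} \<in> E))"

text \<open>\<open>p\<close> consists of the vertices of a path from \<open>u\<close> to
  \<open>v\<close> in \<open>G - F\<close>; deleting any set \<open>Y\<close> disjoint from it
  leaves the path intact.\<close>

lemma component_finite_witness: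
  assumes "v \<in> component F u"
  shows "\<exists>p. finite p \<and> (\<forall>Y. p \<inter> Y = {} \<longrightarrow> v \<in> component (F \<union> Y) u)"
  using assms
proof (induction rule: component_induct)
  case refl
  show ?case by (intro exI[of _ "{}"]) auto
next
  case (step v w)
  then obtain p where p: "finite p" "\<And>Y. p \<inter> Y = {} \<Longrightarrow> v \<in> component (F \<union> Y) u" by blast
  have "w \<in> component (F \<union> Y) u" if "insert v (insert w p) \<inter> Y = {}" for Y
    using component_step[of v "F \<union> Y" u w] p(2)[of Y] step.hyps that by simp
  then show ?case using p(1) by (intro exI[of _ "insert v (insert w p)"]) simp
qed

lemma component_antimono:
  assumes "F \<subseteq> F'"
  shows "component F' u \<subseteq> component F u"
proof -
  have "adj F' \<subseteq> adj F" using assms by (auto simp: adj_def)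
  then have "(adj F')\<^sup>* \<subseteq> (adj F)\<^sup>*" by (rule rtrancl_mono)
  then show ?thesis by (auto simp: component_def)
qed

lemma finite_minsep: "finite {Y. finite Y \<and> card Y = n \<and> minsep u v F Y}"
proof (induction n arbitrary: F)
  case 0
  have "{Y. finite Y \<and> card Y = 0 \<and> minsep u v F Y} \<subseteq> {{}}" by auto
  then show ?case by (rule finite_subset) simp
next
  case (Suc n)
  show ?case
  proof (cases "v \<in> component F u")
    case False
    \<comment> \<open>When \<open>F\<close> alone separates \<open>u\<close> from \<open>v\<close>,
      a vertex of \<open>Y\<close> with neighbours in both components would reconnect them in
      \<open>G - F\<close>.\<close>
    have "\<not> minsep u v F Y" if "card Y = Suc n" for Y
    proof
      assume m: "minsep u v F Y"
      obtain y where y: "y \<in> Y" using card_eq_SucD[OF \<open>card Y = Suc n\<close>] by blast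
      then obtain a b where ab: "a \<in> component (F \<union> Y) u" "{a, y} \<in> E" "b \<in> component (F \<union> Y) v" "{b, y} \<in> E"
        using m unfolding minsep_def by blast
      have "y \<notin> F" "a \<notin> F" "b \<notin> F"
        using y m component_notin[OF ab(1)] component_notin[OF ab(3)] unfolding minsep_def by blast+
      moreover have "a \<in> component F u" "b \<in> component F v"
        using ab component_antimono[of F "F \<union> Y"] by blast+
      ultimately have "y \<in> component F u" "y \<in> component F v"
        using component_step[of a F u y] component_step[of b F v y] ab by simp_all
      then show False using False component_sym[of y F v] component_trans[of y F u v] by simp
    qed
    then have "{Y. finite Y \<and> card Y = Suc n \<and> minsep u v F Y} = {}" by simp
    then show ?thesis by (simp only: finite.emptyI)
  next
    case True
    obtain p where p: "finite p" "\<And>Y. p \<inter> Y = {} \<Longrightarrow> v \<in> component (F \<union> Y) u"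
      using component_finite_witness[OF True] by blast
    \<comment> \<open>A vertex of \<open>Y\<close> on the path is moved into \<open>F\<close>. This
      leaves \<open>F \<union> Y\<close> unchanged, hence also both components, and lowers the size
      of the separator by one.\<close>
    have "{Y. finite Y \<and> card Y = Suc n \<and> minsep u v F Y} \<subseteq>
      (\<Union>y\<in>p. insert y ` {Y. finite Y \<and> card Y = n \<and> minsep u v (insert y F) Y})"
    proof
      fix Y assume Y: "Y \<in> {Y. finite Y \<and> card Y = Suc n \<and> minsep u v F Y}"
      then have "v \<notin> component (F \<union> Y) u" by (simp add: minsep_def)
      then obtain y where y: "y \<in> p" "y \<in> Y" using p(2)[of Y] by blast
      have eq: "insert y F \<union> (Y - {y}) = F \<union> Y" using y by blast
      have "minsep u v (insert y F) (Y - {y})"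
        using Y y unfolding minsep_def eq mem_Collect_eq by blast
      moreover have "card (Y - {y}) = n" "finite (Y - {y})" "Y = insert y (Y - {y})"
        using Y y by auto
      ultimately show "Y \<in> (\<Union>y\<in>p. insert y ` {Y. finite Y \<and> card Y = n \<and> minsep u v (insert y F) Y})"
        using y(1) by blast
    qed
    then show ?thesis by (rule finite_subset) (use p(1) Suc in auto)
  qed
qed

text \<open>If \<open>Y\<close> crosses \<open>X\<close>, then \<open>X\<close> meets every full
  component of \<open>G - Y\<close>. So \<open>Y\<close> is a minimal separator of two vertices of
  \<open>X\<close>, and the finite set \<open>X\<close> has only finitely many pairs.\<close>

lemma finite_cross:
  assumes X: "tight X"
  shows "finite {Y. tight Y \<and> card Y \<le> n \<and> cross X Y}"
proof -
  have "{Y. tight Y \<and> card Y \<le> n \<and> cross X Y} \<subseteq>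
    (\<Union>u\<in>X. \<Union>v\<in>X. \<Union>m\<in>{..n}. {Y. finite Y \<and> card Y = m \<and> minsep u v {} Y})"
  proof
    fix Y assume Y: "Y \<in> {Y. tight Y \<and> card Y \<le> n \<and> cross X Y}"
    then obtain C D where CD: "full Y C" "full Y D" "C \<inter> D = {}" "finite Y" by (auto simp: tight_def)
    obtain u v where uv: "u \<in> C \<inter> X" "v \<in> D \<inter> X"
      using cross_full_meets[OF X, of Y C] cross_full_meets[OF X, of Y D] Y CD by blast
    have eq: "component Y u = C" "component Y v = D"
      using uv fullD(4)[OF CD(1), of u] fullD(4)[OF CD(2), of v] by simp_all
    have "minsep u v {} Y"
      unfolding minsep_def using uv eq CD fullD(2)[OF CD(1)] fullD(2)[OF CD(2)] fullD(5)[OF CD(1)] fullD(5)[OF CD(2)]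
      by (auto simp: insert_commute)
    then show "Y \<in> (\<Union>u\<in>X. \<Union>v\<in>X. \<Union>m\<in>{..n}. {Y. finite Y \<and> card Y = m \<and> minsep u v {} Y})"
      using uv Y CD(4) by auto
  qed
  then show ?thesis by (rule finite_subset) (use X finite_minsep in \<open>auto simp: tight_def\<close>)
qed

section \<open>Regular profiles\<close>

definition rprofile :: "'a osep set \<Rightarrow> bool" where
  "rprofile P \<longleftrightarrow> (\<exists>k::nat. profile V E (enat k) P) \<and> regular V P"

lemma sep_order_less_iff: "sep_order (A, B) < enat k \<longleftrightarrow> finite (A \<inter> B) \<and> card (A \<inter> B) < k"
  by simp

lemma separation_swap: "separation V E (A, B) \<Longrightarrow> separation V E (B, A)"
  using insert_commute[of _ _ "{}"] by (metis Un_commute separation.simps)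

lemma separation_join:
  assumes "separation V E (A, B)" "separation V E (C, D)"
  shows "separation V E (A \<union> C, B \<inter> D)"
  using assms by auto

lemma separation_union_components:
  assumes "X \<subseteq> V" "W \<subseteq> V - X" "\<And>w. w \<in> W \<Longrightarrow> component X w \<subseteq> W"
  shows "separation V E (V - W, W \<union> X)" "(V - W) \<inter> (W \<union> X) = X"
proof -
  have "{x, y} \<notin> E" if "x \<in> (V - W) - (W \<union> X)" "y \<in> (W \<union> X) - (V - W)" for x y
  proof
    assume e: "{x, y} \<in> E"
    have "y \<in> W" "y \<notin> X" "x \<notin> X" using that assms(1,2) by auto
    moreover have "{y, x} \<in> E" using e by (simp add: insert_commute)
    ultimately have "x \<in> component X y" using component_step[of y X y x] by simp
    then show False using assms(3)[OF \<open>y \<in> W\<close>] that by blast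
  qed
  moreover have "(V - W) \<union> (W \<union> X) = V" using assms by blast
  ultimately show "separation V E (V - W, W \<union> X)" by simp
  show "(V - W) \<inter> (W \<union> X) = X" using assms by blast
qed

section \<open>Profile axioms in elementary form\<close>

lemma profile_mem:
  assumes "profile V E k P" "(A, B) \<in> P"
  shows "separation V E (A, B)" "sep_order (A, B) < k"
  using assms(1)[unfolded profile_def, THEN conjunct1] assms(2) by blast+

lemma profile_orient:
  assumes "profile V E k P" "separation V E (A, B)" "sep_order (A, B) < k"
  shows "(A, B) \<in> P \<or> (B, A) \<in> P"
  using assms(1)[unfolded profile_def, THEN conjunct2, THEN conjunct1, rule_format, OF conjI, OF assms(2,3)]
  by blast

lemma profile_consistent:
  assumes "profile V E k P" "(A, B) \<in> P" "(C, D) \<in> P" "{A, B} \<noteq> {C, D}"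
  shows "\<not> (B \<subseteq> C \<and> D \<subseteq> A)"
  using assms(1)[unfolded profile_def, THEN conjunct2, THEN conjunct2, THEN conjunct1, rule_format,
      of A B C D] assms(2-4) by simp

lemma profile_join:
  assumes "profile V E k P" "(A, B) \<in> P" "(C, D) \<in> P"
  shows "(B \<inter> D, A \<union> C) \<notin> P"
  using assms(1)[unfolded profile_def, THEN conjunct2, THEN conjunct2, THEN conjunct2, rule_format,
      of A B C D] assms(2,3) by simp

lemma rprofileD:
  assumes "rprofile P" "(A, B) \<in> P"
  shows "separation V E (A, B)" "finite (A \<inter> B)" "A \<noteq> V"
proof -
  obtain k :: nat where k: "profile V E (enat k) P" "regular V P"
    using assms(1) unfolding rprofile_def by blast
  show "separation V E (A, B)" using profile_mem(1)[OF k(1) assms(2)] .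
  show "finite (A \<inter> B)" using profile_mem(2)[OF k(1) assms(2)] sep_order_less_iff by blast
  show "A \<noteq> V" using k(2) assms(2) unfolding regular_def by blast
qed

text \<open>The index of a profile is kept implicit: every separation whose order is at most that of some
  member is oriented.\<close>

lemma rprofile_orient:
  assumes "rprofile P" "(A, B) \<in> P" "separation V E (C, D)" "finite (C \<inter> D)"
    "card (C \<inter> D) \<le> card (A \<inter> B)"
  shows "(C, D) \<in> P \<or> (D, C) \<in> P"
proof -
  obtain k :: nat where k: "profile V E (enat k) P"
    using assms(1) unfolding rprofile_def by blast
  have "sep_order (A, B) < enat k"
    using profile_mem(2)[OF k assms(2)] .
  then have "sep_order (C, D) < enat k" using assms(4,5) by (simp split: if_splits)
  then show ?thesis by (rule profile_orient[OF k assms(3)])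
qed

lemma rprofile_join:
  assumes "rprofile P" "(A, B) \<in> P" "(C, D) \<in> P" "card ((A \<union> C) \<inter> (B \<inter> D)) \<le> card (A \<inter> B)"
  shows "(A \<union> C, B \<inter> D) \<in> P"
proof -
  obtain k :: nat where k: "profile V E (enat k) P"
    using assms(1) unfolding rprofile_def by blast
  have "finite ((A \<union> C) \<inter> (B \<inter> D))"
    using rprofileD(2)[OF assms(1,2)] rprofileD(2)[OF assms(1,3)]
    by (rule finite_subset[rotated, OF finite_UnI]) blast
  from rprofile_orient[OF assms(1,2) separation_join[OF rprofileD(1)[OF assms(1,2)] rprofileD(1)[OF assms(1,3)]] this assms(4)]
  have "(A \<union> C, B \<inter> D) \<in> P \<or> (B \<inter> D, A \<union> C) \<in> P" .
  moreover have "(B \<inter> D, A \<union> C) \<notin> P"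
    by (rule profile_join[OF k assms(2,3)])
  ultimately show ?thesis by blast
qed

text \<open>\<open>(A', B')\<close> serves only to bound the order of \<open>(C, D)\<close>, so that
  \<open>P\<close> orients it. Consistency does not apply when \<open>(A, B)\<close> and
  \<open>(D, C)\<close> have the same underlying separation; if they coincide, then
  \<open>A = V\<close>, which regularity forbids.\<close>

lemma rprofile_down:
  assumes "rprofile P" "(A, B) \<in> P" "separation V E (C, D)" "C \<subseteq> A" "B \<subseteq> D" "finite (C \<inter> D)"
    "(A', B') \<in> P" "card (C \<inter> D) \<le> card (A' \<inter> B')"
  shows "(C, D) \<in> P"
proof (rule ccontr)
  assume n: "(C, D) \<notin> P"
  obtain k :: nat where k: "profile V E (enat k) P"
    using assms(1) unfolding rprofile_def by blast
  have DC: "(D, C) \<in> P" using rprofile_orient[OF assms(1,7,3,6,8)] n by blast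
  show False
  proof (cases "{A, B} = {D, C}")
    case False
    then show False using profile_consistent[OF k assms(2) DC] assms(4,5) by simp
  next
    case True
    then consider "A = D" "B = C" | "A = C" "B = D" by (auto simp: doubleton_eq_iff)
    then show False
    proof cases
      case 1
      then have "A = V" using assms(3-5) by auto
      then show False using rprofileD(3)[OF assms(1,2)] by blast
    next
      case 2
      then show False using n assms(2) by blast
    qed
  qed
qed

text \<open>If no component of \<open>G - X\<close> is chosen by \<open>P\<close>, then \<open>P\<close> induces a non-principal ultrafilter on the
  set of components of \<open>G - X\<close>, and this ultrafilter orients all separations of finite order.\<close>

lemma bounded_profile_component:
  assumes P: "rprofile P" and bounded: "bounded_profile V E P" and AB: "(A, B) \<in> P"
    and X_def: "X = A \<inter> B"
  shows "\<exists>u\<in>V - X. (V - component X u, component X u \<union> X) \<in> P"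
proof (rule ccontr)
  assume neg: "\<not> ?thesis"
  have XV: "X \<subseteq> V" and finX: "finite X"
    using rprofileD(1,2)[OF P AB] X_def by auto
  define closed where "closed W \<longleftrightarrow> W \<subseteq> V - X \<and> (\<forall>w\<in>W. component X w \<subseteq> W)" for W
  \<comment> \<open>The prospective ultrafilter: \<open>closed\<close> sets are the unions of
    components of \<open>G - X\<close>, and \<open>U W\<close> says that \<open>P\<close> points to
    \<open>W\<close>.\<close>
  define U where "U W \<longleftrightarrow> closed W \<and> (V - W, W \<union> X) \<in> P" for W
  have closed_sep: "separation V E (V - W, W \<union> X)" "(V - W) \<inter> (W \<union> X) = X" if "closed W" for W
    using separation_union_components[OF XV, of W] that unfolding closed_def by blast+
  have closed_compl: "closed (V - X - W)" if W: "closed W" for W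
    unfolding closed_def
  proof (intro conjI ballI)
    fix w assume w: "w \<in> V - X - W"
    show "component X w \<subseteq> V - X - W"
    proof
      fix v assume v: "v \<in> component X w"
      have "v \<in> V" using v component_subset_V[of w X] w by blast
      moreover have "v \<notin> X" using component_notin[OF v] w by blast
      moreover have "v \<notin> W"
        using W w component_sym[OF v] unfolding closed_def by blast
      ultimately show "v \<in> V - X - W" by blast
    qed
  qed blast
  have U_compl: "U W \<or> U (V - X - W)" if W: "closed W" for W
  proof -
    have "card ((V - W) \<inter> (W \<union> X)) \<le> card (A \<inter> B)" "finite ((V - W) \<inter> (W \<union> X))"
      using closed_sep(2)[OF W] X_def finX by simp_all
    then have "(V - W, W \<union> X) \<in> P \<or> (W \<union> X, V - W) \<in> P"
      using rprofile_orient[OF P AB closed_sep(1)[OF W]] by blast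
    moreover have "V - (V - X - W) = W \<union> X" "(V - X - W) \<union> X = V - W"
      using W XV unfolding closed_def by blast+
    ultimately show ?thesis using W closed_compl[OF W] unfolding U_def by simp
  qed
  have U_int: "U (W \<inter> W')" if W: "U W" "U W'" for W W'
  proof -
    have c: "closed (W \<inter> W')" using W unfolding U_def closed_def by blast
    have eq: "(V - W) \<union> (V - W') = V - W \<inter> W'" "(W \<union> X) \<inter> (W' \<union> X) = (W \<inter> W') \<union> X" by blast+
    have "card (((V - W) \<union> (V - W')) \<inter> ((W \<union> X) \<inter> (W' \<union> X))) \<le> card ((V - W) \<inter> (W \<union> X))"
      unfolding eq using closed_sep(2)[OF c] closed_sep(2)[of W] W unfolding U_def by simp
    from rprofile_join[OF P _ _ this] have "(V - W \<inter> W', (W \<inter> W') \<union> X) \<in> P"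
      using W unfolding U_def eq by blast
    then show ?thesis using c unfolding U_def by blast
  qed
  \<comment> \<open>\<open>U {}\<close> would put \<open>(V, X)\<close> into the regular profile
    \<open>P\<close>.\<close>
  have U_empty: "\<not> U {}"
    using rprofileD(3)[OF P] unfolding U_def by force
  have closed_comp: "closed (component X u)" if u: "u \<in> V - X" for u
    using component_subset_V[of u X] component_notin[of _ X u] component_eq[of _ X u] u
    unfolding closed_def by blast
  have U_avoid: "U (V - X - component X u)" if u: "u \<in> V - X" for u
    using U_compl[OF closed_comp[OF u]] neg u unfolding U_def by blast
  have U_top: "U (V - X)"
  proof -
    have "closed {}" unfolding closed_def by blast
    from U_compl[OF this] U_empty show ?thesis by simp
  qed
  \<comment> \<open>Non-principality in the form needed below: as no single component is chosen, the
    finitely many components meeting \<open>S\<close> can be discarded one at a time.\<close>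
  have U_avoid_finite: "U {x \<in> V - X. component X x \<inter> S = {}}" if "finite S" for S
    using that
  proof (induction S rule: finite_induct)
    case empty
    have "{x \<in> V - X. component X x \<inter> {} = {}} = V - X" by blast
    then show ?case using U_top by simp
  next
    case (insert s S)
    show ?case
    proof (cases "s \<in> V - X")
      case True
      have "{x \<in> V - X. component X x \<inter> insert s S = {}} =
          {x \<in> V - X. component X x \<inter> S = {}} \<inter> (V - X - component X s)"
        using component_sym[of _ X s] component_sym[of s X] by blast
      then show ?thesis using U_int[OF insert.IH U_avoid[OF True]] by simp
    next
      case False
      then have "s \<notin> component X x" if "x \<in> V - X" for x
        using component_subset_V[of x X] component_notin[of s X x] that by blast
      then have "{x \<in> V - X. component X x \<inter> insert s S = {}} = {x \<in> V - X. component X x \<inter> S = {}}"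
        by blast
      then show ?thesis using insert.IH by simp
    qed
  qed
  define W where "W C D = {x \<in> V - X. component X x \<subseteq> D - C}" for C D :: "'a set"
  have closed_W: "closed (W C D)" for C D
    unfolding closed_def
  proof (intro conjI ballI)
    show "W C D \<subseteq> V - X" unfolding W_def by blast
    fix w assume w: "w \<in> W C D"
    show "component X w \<subseteq> W C D"
    proof
      fix v assume v: "v \<in> component X w"
      then have "v \<in> V - X" using closed_comp[of w] w unfolding closed_def W_def by blast
      moreover have "component X v \<subseteq> D - C" using component_eq[OF v] w unfolding W_def by simp
      ultimately show "v \<in> W C D" unfolding W_def by blast
    qed
  qed
  have W_memD: "x \<in> D - C" if "x \<in> W C D" for x C D
    using that component_refl[of x X] unfolding W_def by blast
  \<comment> \<open>\<open>W C D\<close> is the union of the components of \<open>G - X\<close>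
    lying strictly on the \<open>D\<close> side. \<open>Q\<close> orients every separation of finite
    order towards the side that is large for the ultrafilter; the finitely many components meeting
    \<open>C \<inter> D\<close> do not count.\<close>
  define Q where "Q = {(C, D). separation V E (C, D) \<and> finite (C \<inter> D) \<and> U (W C D)}"
  have U_disj: "False" if "U (W C D)" "U (W C' D')" "(D - C) \<inter> (D' - C') = {}" for C D C' D'
  proof -
    have "W C D \<inter> W C' D' = {}" using W_memD that(3) by blast
    then show False using U_int[OF that(1,2)] U_empty by simp
  qed
  have Q_orient: "U (W C D) \<or> U (W D C)" if CD: "separation V E (C, D)" "finite (C \<inter> D)" for C D
  proof (rule ccontr)
    assume n: "\<not> ?thesis"
    then have "U (V - X - W C D)" "U (V - X - W D C)"
      using U_compl[OF closed_W] by blast+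
    then have "U ((V - X - W C D) \<inter> (V - X - W D C) \<inter> {x \<in> V - X. component X x \<inter> (C \<inter> D) = {}})"
      using U_int U_avoid_finite[OF CD(2)] by blast
    moreover have "x \<in> W C D \<or> x \<in> W D C" if x: "x \<in> V - X" "component X x \<inter> (C \<inter> D) = {}" for x
    proof -
      have sub: "component X x \<subseteq> component (C \<inter> D) x" using component_avoid[OF x(2)] .
      have "x \<notin> C \<inter> D" using x(2) component_refl[of x X] by blast
      then consider "x \<in> C - D" | "x \<in> D - C" using x(1) CD(1) by auto
      then show ?thesis
      proof cases
        case 1
        from component_side[OF CD(1) 1] sub show ?thesis using x(1) unfolding W_def by blast
      next
        case 2
        then have "component (C \<inter> D) x \<subseteq> D - C"
          using component_side[OF separation_swap[OF CD(1)] 2] by (simp only: Int_commute)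
        then show ?thesis using sub x(1) unfolding W_def by blast
      qed
    qed
    then have "(V - X - W C D) \<inter> (V - X - W D C) \<inter> {x \<in> V - X. component X x \<inter> (C \<inter> D) = {}} = {}"
      by blast
    ultimately show False using U_empty by simp
  qed
  have "profile V E \<infinity> Q"
    unfolding profile_def
  proof (intro conjI allI impI ballI)
    fix s assume s: "s \<in> Q"
    obtain C D where "s = (C, D)" by fastforce
    then show "separation V E s" "sep_order s < \<infinity>" using s unfolding Q_def by simp_all
  next
    fix C D assume "separation V E (C, D) \<and> sep_order (C, D) < \<infinity>"
    then have CD: "separation V E (C, D)" "finite (C \<inter> D)" by (simp_all split: if_splits)
    have DC: "separation V E (D, C)" "finite (D \<inter> C)"
      using separation_swap[OF CD(1)] CD(2) by (simp_all only: Int_commute)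
    have "\<not> (U (W C D) \<and> U (W D C))" using U_disj[of C D D C] by blast
    then have "((C, D) \<in> Q) \<noteq> ((D, C) \<in> Q)"
      using Q_orient[OF CD] CD DC unfolding Q_def by blast
    then show "\<exists>!s. s \<in> {(C, D), (D, C)} \<and> s \<in> Q" by blast
  next
    fix C D C' D' assume *: "(C, D) \<in> Q \<and> (C', D') \<in> Q \<and> {C, D} \<noteq> {C', D'}"
    show "\<not> sep_le (D, C) (C', D')"
    proof
      assume "sep_le (D, C) (C', D')"
      then have "(D - C) \<inter> (D' - C') = {}" by auto
      then show False using * U_disj unfolding Q_def by blast
    qed
  next
    fix C D C' D' assume *: "(C, D) \<in> Q \<and> (C', D') \<in> Q"
    show "(D \<inter> D', C \<union> C') \<notin> Q"
    proof
      assume "(D \<inter> D', C \<union> C') \<in> Q"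
      then have "U (W (D \<inter> D') (C \<union> C'))" "U (W C D \<inter> W C' D')"
        using * U_int unfolding Q_def by blast+
      then have "U (W (D \<inter> D') (C \<union> C') \<inter> (W C D \<inter> W C' D'))" using U_int by blast
      moreover have "W (D \<inter> D') (C \<union> C') \<inter> (W C D \<inter> W C' D') = {}" using W_memD by blast
      ultimately show False using U_empty by simp
    qed
  qed
  moreover have "P \<subseteq> Q"
  proof
    fix s assume s: "s \<in> P"
    obtain C D where sCD: "s = (C, D)" by fastforce
    have CD: "(C, D) \<in> P" using s sCD by simp
    note sep = rprofileD(1,2)[OF P CD]
    have "U (W C D)"
    proof (rule ccontr)
      assume "\<not> ?thesis"
      then have W: "(V - W D C, W D C \<union> X) \<in> P" using Q_orient[OF sep] unfolding U_def by blast
      \<comment> \<open>If \<open>P\<close> pointed away from \<open>W D C\<close>, the join of that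
        member with \<open>(C, D)\<close> would have first side \<open>V\<close> and order at most
        \<open>card X\<close>, against regularity.\<close>
      have eq: "(V - W D C) \<union> C = V" using W_memD[of _ D C] sep(1) by auto
      have "(W D C \<union> X) \<inter> D \<subseteq> X" using W_memD[of _ D C] by blast
      then have "card (((V - W D C) \<union> C) \<inter> ((W D C \<union> X) \<inter> D)) \<le> card ((V - W D C) \<inter> (W D C \<union> X))"
        using closed_sep(2)[OF closed_W] finX by (intro card_mono) auto
      from rprofile_join[OF P W CD this] show False using rprofileD(3)[OF P] eq by metis
    qed
    then show "s \<in> Q" using sep sCD unfolding Q_def by simp
  qed
  ultimately show False using bounded unfolding bounded_profile_def by blast
qed

section \<open>Efficient distinguishers\<close>

text \<open>\<open>P\<close> points to \<open>B - A\<close> and \<open>P'\<close> to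
  \<open>A - B\<close>. Comparing with one orientation of the competitors suffices, since their
  sides can be renamed. \<open>card\<close> measures orders faithfully because members of profiles
  of finite index have finite order.\<close>

definition eff :: "'a osep set \<Rightarrow> 'a osep set \<Rightarrow> 'a set \<Rightarrow> 'a set \<Rightarrow> bool" where
  "eff P P' A B \<longleftrightarrow> (A, B) \<in> P \<and> (B, A) \<in> P' \<and>
     (\<forall>C D. (C, D) \<in> P \<and> (D, C) \<in> P' \<longrightarrow> card (A \<inter> B) \<le> card (C \<inter> D))"

definition good :: "'a osep set \<Rightarrow> bool" where
  "good P \<longleftrightarrow> rprofile P \<and> bounded_profile V E P \<and> robust V E P"

lemma eff_swap: "eff P P' A B \<Longrightarrow> eff P' P B A"
  unfolding eff_def by (metis Int_commute)

lemma effD: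
  assumes "eff P P' A B"
  shows "(A, B) \<in> P" "(B, A) \<in> P'" "\<And>C D. (C, D) \<in> P \<Longrightarrow> (D, C) \<in> P' \<Longrightarrow> card (A \<inter> B) \<le> card (C \<inter> D)"
  using assms unfolding eff_def by blast+

lemma eff_card_eq: "eff P P' A B \<Longrightarrow> eff P P' C D \<Longrightarrow> card (A \<inter> B) = card (C \<inter> D)"
  unfolding eff_def by (simp add: le_antisym)

text \<open>The component chosen by \<open>P\<close> lies in \<open>B - A\<close>, since otherwise
  joining with \<open>(A, B)\<close> would give \<open>(V, X)\<close>. It is full by efficiency: a
  component with smaller neighbourhood could be cut off more cheaply.\<close>

lemma eff_full:
  assumes P: "rprofile P" "bounded_profile V E P" and P': "rprofile P'" and e: "eff P P' A B"
    and X_def: "X = A \<inter> B"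
  shows "\<exists>C. full X C \<and> C \<subseteq> B - A \<and> (V - C, C \<union> X) \<in> P"
proof -
  note AB = effD(1)[OF e] and BA = effD(2)[OF e]
  note sep = rprofileD(1)[OF P(1) AB]
  have finX: "finite X" using rprofileD(2)[OF P(1) AB] X_def by simp
  have XV: "X \<subseteq> V" using sep X_def by auto
  obtain u where u: "u \<in> V - X" and uP: "(V - component X u, component X u \<union> X) \<in> P"
    using bounded_profile_component[OF P AB X_def] by blast
  define C where "C = component X u"
  have CP: "(V - C, C \<union> X) \<in> P" using uP by (simp only: C_def)
  have CV: "C \<subseteq> V" "C \<inter> X = {}" "u \<in> C"
    using component_subset_V[of u X] component_notin[of _ X u] u unfolding C_def by auto
  have int: "(V - C) \<inter> (C \<union> X) = X" using CV XV by blast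
  have CBA: "C \<subseteq> B - A"
  proof (cases "u \<in> A - B")
    case True
    have "C \<subseteq> A - B" using component_side[OF sep True] unfolding C_def X_def .
    then have eq: "(V - C) \<union> A = V" "(C \<union> X) \<inter> B = X" using sep X_def by auto
    have "card (((V - C) \<union> A) \<inter> ((C \<union> X) \<inter> B)) \<le> card ((V - C) \<inter> (C \<union> X))"
      unfolding eq int using XV by (simp add: Int_absorb1)
    from rprofile_join[OF P(1) CP AB this] show ?thesis
      using rprofileD(3)[OF P(1)] eq(1) by metis
  next
    case False
    then have "u \<in> B - A" using u sep X_def by auto
    from component_side[OF separation_swap[OF sep] this] show ?thesis
      unfolding C_def X_def by (simp only: Int_commute)
  qed
  have "\<exists>c\<in>C. {x, c} \<in> E" if x: "x \<in> X" for x
  proof (rule ccontr)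
    assume n: "\<not> ?thesis"
    \<comment> \<open>\<open>N\<close> is the neighbourhood of \<open>C\<close>. Then
      \<open>(V - C, C \<union> N)\<close> would distinguish \<open>P\<close> from \<open>P'\<close>
      with order below that of \<open>(A, B)\<close>: for \<open>P\<close> the other orientation is
      excluded by a join equal to \<open>(V, X)\<close>, and for \<open>P'\<close> the inverse lies
      below \<open>(B, A)\<close>.\<close>
    define N where "N = {y \<in> X. \<exists>c\<in>C. {y, c} \<in> E}"
    have "N \<subset> X" using n x unfolding N_def by blast
    then have cN: "card N < card X" using finX by (rule psubset_card_mono[rotated])
    have NX: "N \<subseteq> X" "finite N" using finX unfolding N_def by auto
    have intN: "(V - C) \<inter> (C \<union> N) = N" "(C \<union> N) \<inter> (V - C) = N" using CV XV NX by blast+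
    have "{y, c} \<notin> E" if y: "y \<in> (V - C) - (C \<union> N)" and c: "c \<in> (C \<union> N) - (V - C)" for y c
    proof
      assume yc: "{y, c} \<in> E"
      have c': "c \<in> C" "c \<notin> X" using c NX XV CV by auto
      show False
      proof (cases "y \<in> X")
        case True
        then show False using yc c'(1) y unfolding N_def by blast
      next
        case False
        have "{c, y} \<in> E" using yc by (simp add: insert_commute)
        then have "y \<in> C" using component_step[of c X u y] c' False unfolding C_def by blast
        then show False using y by blast
      qed
    qed
    moreover have "(V - C) \<union> (C \<union> N) = V" using CV NX XV by blast
    ultimately have sepN: "separation V E (V - C, C \<union> N)" by simp
    have "(V - C, C \<union> N) \<in> P"
    proof (rule ccontr)
      assume "(V - C, C \<union> N) \<notin> P"
      moreover have "card ((V - C) \<inter> (C \<union> N)) \<le> card (A \<inter> B)" "finite ((V - C) \<inter> (C \<union> N))"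
        unfolding intN using cN NX X_def by simp_all
      ultimately have *: "(C \<union> N, V - C) \<in> P" using rprofile_orient[OF P(1) AB sepN] by blast
      have eq: "(V - C) \<union> (C \<union> N) = V" "(C \<union> X) \<inter> (V - C) = X" using CV NX XV by blast+
      have "card (((V - C) \<union> (C \<union> N)) \<inter> ((C \<union> X) \<inter> (V - C))) \<le> card ((V - C) \<inter> (C \<union> X))"
        unfolding eq int using XV by (simp add: Int_absorb1)
      from rprofile_join[OF P(1) CP * this] show False
        using rprofileD(3)[OF P(1)] eq(1) by metis
    qed
    moreover have "(C \<union> N, V - C) \<in> P'"
    proof (rule rprofile_down[OF P' BA separation_swap[OF sepN] _ _ _ BA])
      show "C \<union> N \<subseteq> B" "A \<subseteq> V - C" using CBA NX X_def sep by auto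
      show "finite ((C \<union> N) \<inter> (V - C))" "card ((C \<union> N) \<inter> (V - C)) \<le> card (B \<inter> A)"
        unfolding intN using NX cN X_def by (simp_all add: Int_commute)
    qed
    ultimately have "card (A \<inter> B) \<le> card ((V - C) \<inter> (C \<union> N))" by (rule effD(3)[OF e])
    then show False using cN unfolding intN X_def by simp
  qed
  then have "full X C" using u unfolding full_def C_def by blast
  then show ?thesis using CBA CP by blast
qed

lemma eff_tight:
  assumes "good P" "good P'" "eff P P' A B"
  shows "tight (A \<inter> B)"
proof -
  have P: "rprofile P" "bounded_profile V E P" "rprofile P'" "bounded_profile V E P'"
    using assms unfolding good_def by blast+
  obtain C where C: "full (A \<inter> B) C" "C \<subseteq> B - A"
    using eff_full[OF P(1-3) assms(3) refl] by blast
  obtain D where D: "full (A \<inter> B) D" "D \<subseteq> A - B"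
    using eff_full[OF P(3,4,1) eff_swap[OF assms(3)] Int_commute] by blast
  have "separation V E (A, B)" "finite (A \<inter> B)"
    using rprofileD(1,2)[OF P(1) effD(1)[OF assms(3)]] .
  moreover have "C \<inter> D = {}" using C D by blast
  ultimately show ?thesis using C(1) D(1) unfolding tight_def by auto
qed

text \<open>There is a full component strictly on each side, and \<open>S\<close> misses one of
  them. This complements \<open>not_cross_side\<close> and is applied to corners, one of whose sides
  contains a given separator.\<close>

lemma eff_side_not_cross:
  assumes "good P" "good P'" "eff P P' A B" "tight S" "S \<subseteq> A \<or> S \<subseteq> B"
  shows "\<not> cross S (A \<inter> B)"
proof -
  have P: "rprofile P" "bounded_profile V E P" "rprofile P'" "bounded_profile V E P'"
    using assms unfolding good_def by blast+
  obtain C where C: "full (A \<inter> B) C" "C \<subseteq> B - A"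
    using eff_full[OF P(1-3) assms(3) refl] by blast
  obtain D where D: "full (A \<inter> B) D" "D \<subseteq> A - B"
    using eff_full[OF P(3,4,1) eff_swap[OF assms(3)] Int_commute] by blast
  have "C \<inter> S = {} \<or> D \<inter> S = {}" using C(2) D(2) assms(5) by blast
  then have "\<not> separates S (A \<inter> B)"
    using full_avoid_not_separates[OF C(1)] full_avoid_not_separates[OF D(1)] by blast
  then show ?thesis using cross_iff[OF assms(4) eff_tight[OF assms(1-3)]] by blast
qed

section \<open>Corners of two efficient separations\<close>

text \<open>Only \<open>P\<close> has to know \<open>(C, D)\<close>: the inverse of the corner lies
  below \<open>(B, A)\<close>, so \<open>P'\<close> contains it however it orients
  \<open>{C, D}\<close>.\<close>

lemma eff_corner:
  assumes P: "rprofile P" and P': "rprofile P'" and e: "eff P P' A B" and CD: "(C, D) \<in> P"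
    and c: "card ((A \<union> C) \<inter> (B \<inter> D)) \<le> card (A \<inter> B)"
  shows "eff P P' (A \<union> C) (B \<inter> D)"
proof -
  note AB = effD(1)[OF e] and BA = effD(2)[OF e]
  have 1: "(A \<union> C, B \<inter> D) \<in> P" by (rule rprofile_join[OF P AB CD c])
  have 2: "(B \<inter> D, A \<union> C) \<in> P'"
  proof (rule rprofile_down[OF P' BA separation_swap[OF rprofileD(1)[OF P 1]] _ _ _ BA])
    show "finite ((B \<inter> D) \<inter> (A \<union> C))" using rprofileD(2)[OF P 1] by (simp only: Int_commute)
    show "card ((B \<inter> D) \<inter> (A \<union> C)) \<le> card (B \<inter> A)" using c by (simp only: Int_commute)
  qed auto
  show ?thesis
    unfolding eff_def using 1 2 c effD(3)[OF e] order_trans by blast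
qed

text \<open>Submodularity holds with equality: as both pairs cover \<open>V\<close>, the two corner
  separators have the same union and the same intersection as \<open>A \<inter> B\<close> and
  \<open>C \<inter> D\<close>.\<close>

lemma corner_card:
  assumes "separation V E (A, B)" "separation V E (C, D)" "finite (A \<inter> B)" "finite (C \<inter> D)"
  shows "card ((A \<union> C) \<inter> (B \<inter> D)) + card ((A \<inter> C) \<inter> (B \<union> D)) = card (A \<inter> B) + card (C \<inter> D)"
proof -
  have AB: "A \<union> B = C \<union> D" using assms(1,2) by simp
  have 1: "((A \<union> C) \<inter> (B \<inter> D)) \<union> ((A \<inter> C) \<inter> (B \<union> D)) = (A \<inter> B) \<union> (C \<inter> D)" using AB by blast
  have 2: "((A \<union> C) \<inter> (B \<inter> D)) \<inter> ((A \<inter> C) \<inter> (B \<union> D)) = (A \<inter> B) \<inter> (C \<inter> D)" by blast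
  have fin: "finite ((A \<union> C) \<inter> (B \<inter> D))" "finite ((A \<inter> C) \<inter> (B \<union> D))"
    by (rule finite_subset[OF _ finite_UnI[OF assms(3,4)]], blast)+
  show ?thesis
    using card_Un_Int[OF fin] card_Un_Int[OF assms(3,4)] unfolding 1 2 by simp
qed

definition separators :: "'a osep set \<Rightarrow> 'a osep set \<Rightarrow> 'a set set" where
  "separators P P' = {A \<inter> B | A B. eff P P' A B}"

lemma separatorsI: "eff P P' A B \<Longrightarrow> X = A \<inter> B \<Longrightarrow> X \<in> separators P P'"
  unfolding separators_def by blast

lemma separators_swap: "separators P P' = separators P' P"
  unfolding separators_def using eff_swap by (metis Int_commute)

lemma separators_tight: "good P \<Longrightarrow> good P' \<Longrightarrow> X \<in> separators P P' \<Longrightarrow> tight X"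
  unfolding separators_def using eff_tight by blast

lemma separators_card: "X \<in> separators P P' \<Longrightarrow> Y \<in> separators P P' \<Longrightarrow> card X = card Y"
  unfolding separators_def using eff_card_eq by blast

text \<open>Robustness is needed only here: it excludes that both corners on the side of \<open>(A, B)\<close> that
  \<open>Q\<close> and \<open>Q'\<close> do not choose have order less than \<open>(A, B)\<close>.\<close>

lemma corner_less:
  assumes good: "good P" "good P'" "good Q" "good Q'"
    and e: "eff P P' A B" and f: "eff Q Q' C D" and less: "card (A \<inter> B) < card (C \<inter> D)"
    and AB: "(A, B) \<in> Q" "(A, B) \<in> Q'"
  shows "eff Q Q' (C \<union> A) (D \<inter> B) \<or> eff Q' Q (D \<union> A) (C \<inter> B)"
proof (rule ccontr)
  assume n: "\<not> ?thesis"
  have r: "rprofile P" "rprofile P'" "rprofile Q" "rprofile Q'" using good unfolding good_def by blast+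
  note sAB = rprofileD(1,2)[OF r(1) effD(1)[OF e]]
  note sCD = rprofileD(1,2)[OF r(3) effD(1)[OF f]]
  note sDC = rprofileD(1,2)[OF r(4) effD(2)[OF f]]
  \<comment> \<open>A corner of order at most that of \<open>(C, D)\<close> would be efficient by
    \<open>eff_corner\<close>. So both corners are larger, and by \<open>corner_card\<close> their
    opposites are smaller than \<open>(A, B)\<close>.\<close>
  have "card (C \<inter> D) < card ((C \<union> A) \<inter> (D \<inter> B))"
    using eff_corner[OF r(3,4) f AB(1)] n by force
  moreover have "card (C \<inter> D) < card ((D \<union> A) \<inter> (C \<inter> B))"
    using eff_corner[OF r(4,3) eff_swap[OF f] AB(2)] n by (force simp: Int_commute)
  moreover note corner_card[OF sCD(1) sAB(1) sCD(2) sAB(2)] corner_card[OF sDC(1) sAB(1) sDC(2) sAB(2)]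
  moreover have "card (D \<inter> C) = card (C \<inter> D)" by (simp only: Int_commute)
  ultimately have lt: "card ((C \<inter> A) \<inter> (D \<union> B)) < card (A \<inter> B)" "card ((D \<inter> A) \<inter> (C \<union> B)) < card (A \<inter> B)"
    by linarith+
  have BA: "(B, A) \<in> P'" "separation V E (B, A)" using effD(2)[OF e] separation_swap[OF sAB(1)] by blast+
  have eq: "(B \<union> C) \<inter> (A \<inter> D) = (D \<inter> A) \<inter> (C \<union> B)" "(B \<union> D) \<inter> (A \<inter> C) = (C \<inter> A) \<inter> (D \<union> B)"
    "B \<inter> A = A \<inter> B" by blast+
  have fin: "finite ((D \<inter> A) \<inter> (C \<union> B))" "finite ((C \<inter> A) \<inter> (D \<union> B))"
    by (rule finite_subset[OF _ finite_UnI[OF sAB(2) sCD(2)]], blast)+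
  have o: "sep_order (sep_join (B, A) (C, D)) < sep_order (B, A)"
    "sep_order (sep_join (B, A) (D, C)) < sep_order (B, A)" "sep_order (C, D) < \<infinity>"
    using lt fin sAB(2) sCD(2) by (simp_all add: eq)
  \<comment> \<open>Robustness, applied to \<open>(B, A)\<close>, puts one of these small joins into
    \<open>P'\<close>. Its inverse lies below \<open>(A, B)\<close> and hence in \<open>P\<close>,
    so it distinguishes the two more cheaply than \<open>(A, B)\<close>.\<close>
  have "robust V E P'" using good(2) unfolding good_def by blast
  then have "sep_join (B, A) (C, D) \<in> P' \<or> sep_join (B, A) (D, C) \<in> P'"
    unfolding robust_def using BA(1) sCD(1) o by blast
  then have "(B \<union> C, A \<inter> D) \<in> P' \<or> (B \<union> D, A \<inter> C) \<in> P'" by simp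
  moreover have False if F: "(B \<union> F, A \<inter> G) \<in> P'" and l: "card ((B \<union> F) \<inter> (A \<inter> G)) < card (A \<inter> B)" for F G
  proof -
    have sw: "(A \<inter> G) \<inter> (B \<union> F) = (B \<union> F) \<inter> (A \<inter> G)" by blast
    have "(A \<inter> G, B \<union> F) \<in> P"
      by (rule rprofile_down[OF r(1) effD(1)[OF e] separation_swap[OF rprofileD(1)[OF r(2) F]] _ _ _ effD(1)[OF e]])
        (use rprofileD(2)[OF r(2) F] l in \<open>auto simp: sw\<close>)
    from effD(3)[OF e this F] l show False by (simp add: sw)
  qed
  ultimately show False using lt eq by metis
qed

text \<open>A double count over separators of size \<open>k\<close>: one that crosses a corner
  crosses \<open>X\<close> or \<open>Y\<close>, and one that crosses both corners crosses both
  \<open>X\<close> and \<open>Y\<close>. Strictness comes from \<open>X\<close> itself, which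
  crosses \<open>Y\<close> but neither corner.\<close>

lemma opposite_corners:
  fixes \<T> :: "'a set set"
  defines "cr \<equiv> \<lambda>Z. card {S \<in> \<T>. card S = card Z \<and> cross Z S}"
  assumes t: "\<And>S. S \<in> \<T> \<Longrightarrow> tight S"
    and sep: "separation V E (A, B)" "separation V E (C, D)"
    and XY: "A \<inter> B \<in> \<T>" "C \<inter> D \<in> \<T>" "cross (A \<inter> B) (C \<inter> D)"
    and Z: "tight ((A \<union> C) \<inter> (B \<inter> D))" "tight ((A \<inter> C) \<inter> (B \<union> D))"
    and k: "card (A \<inter> B) = k" "card (C \<inter> D) = k" "card ((A \<union> C) \<inter> (B \<inter> D)) = k" "card ((A \<inter> C) \<inter> (B \<union> D)) = k"
    and side1: "\<And>S. tight S \<Longrightarrow> S \<subseteq> A \<union> C \<Longrightarrow> \<not> cross S ((A \<union> C) \<inter> (B \<inter> D))"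
    and side2: "\<And>S. tight S \<Longrightarrow> S \<subseteq> B \<union> D \<Longrightarrow> \<not> cross S ((A \<inter> C) \<inter> (B \<union> D))"
  shows "cr ((A \<union> C) \<inter> (B \<inter> D)) + cr ((A \<inter> C) \<inter> (B \<union> D)) < cr (A \<inter> B) + cr (C \<inter> D)"
proof -
  define K where "K Z = {S \<in> \<T>. card S = k \<and> cross Z S}" for Z
  define X Y Z1 Z2 where "X = A \<inter> B" and "Y = C \<inter> D" and "Z1 = (A \<union> C) \<inter> (B \<inter> D)" and "Z2 = (A \<inter> C) \<inter> (B \<union> D)"
  note d = X_def Y_def Z1_def Z2_def
  have tXY: "tight X" "tight Y" "cross X Y" using XY t unfolding d by blast+
  have tZ: "tight Z1" "tight Z2" using Z unfolding d by blast+
  have sub: "Z1 \<subseteq> X \<union> Y" "Z2 \<subseteq> X \<union> Y" "X \<subseteq> A \<union> C" "X \<subseteq> B \<union> D" unfolding d by blast+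
  have fin: "finite (K Z)" if "tight Z" for Z
    by (rule finite_subset[OF _ finite_cross[OF that, of k]]) (use t K_def in auto)
  have un: "K Z1 \<union> K Z2 \<subseteq> K X \<union> K Y"
  proof
    fix S assume "S \<in> K Z1 \<union> K Z2"
    then have S: "S \<in> \<T>" "card S = k" "cross S Z1 \<or> cross S Z2" using cross_sym unfolding K_def by blast+
    have "cross S X \<or> cross S Y"
      using corner_not_cross[OF tXY(1,2) t[OF S(1)] tZ(1) tXY(3) _ _ sub(1)]
        corner_not_cross[OF tXY(1,2) t[OF S(1)] tZ(2) tXY(3) _ _ sub(2)] S(3) by blast
    then show "S \<in> K X \<union> K Y" using S(1,2) cross_sym unfolding K_def by blast
  qed
  have "X \<in> K Y" using XY k(1) cross_sym unfolding K_def d by blast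
  moreover have "X \<notin> K Z1 \<union> K Z2"
    using side1[OF tXY(1) sub(3)] side2[OF tXY(1) sub(4)] cross_sym unfolding K_def Z1_def Z2_def by blast
  ultimately have "K Z1 \<union> K Z2 \<subset> K X \<union> K Y" using un by blast
  then have 1: "card (K Z1 \<union> K Z2) < card (K X \<union> K Y)"
    using fin tXY by (intro psubset_card_mono) simp_all
  have "S \<in> K X \<inter> K Y" if "S \<in> K Z1 \<inter> K Z2" for S
  proof -
    have S: "S \<in> \<T>" "card S = k" "cross S Z1" "cross S Z2" using that cross_sym unfolding K_def by blast+
    have tS: "tight S" "S \<subseteq> V" using t[OF S(1)] unfolding tight_def by blast+
    \<comment> \<open>Lying in neither \<open>A \<union> C\<close> nor \<open>B \<union> D\<close>
      means having vertices outside each of the four sides, so by \<open>not_cross_side\<close>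
      \<open>S\<close> crosses both \<open>X\<close> and \<open>Y\<close>.\<close>
    have n: "\<not> S \<subseteq> A \<union> C" "\<not> S \<subseteq> B \<union> D"
      using side1[OF tS(1)] side2[OF tS(1)] S(3,4) unfolding Z1_def Z2_def by blast+
    have "cross X S" using not_cross_side[OF sep(1) _ tS(2)] n unfolding X_def by blast
    moreover have "cross Y S" using not_cross_side[OF sep(2) _ tS(2)] n unfolding Y_def by blast
    ultimately show ?thesis using S(1,2) unfolding K_def by blast
  qed
  then have 2: "card (K Z1 \<inter> K Z2) \<le> card (K X \<inter> K Y)"
    using fin[OF tXY(1)] by (intro card_mono) auto
  have "card (K Z1) + card (K Z2) < card (K X) + card (K Y)"
    using 1 2 card_Un_Int[OF fin[OF tZ(1)] fin[OF tZ(2)]] card_Un_Int[OF fin[OF tXY(1)] fin[OF tXY(2)]]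
    by linarith
  moreover have "cr X = card (K X)" "cr Y = card (K Y)" "cr Z1 = card (K Z1)" "cr Z2 = card (K Z2)"
    using k unfolding cr_def K_def d by simp_all
  ultimately show ?thesis unfolding d by simp
qed

text \<open>The propositional skeleton of the argument for two separations of equal order \<open>k\<close>: the variable
  \<open>oBD\<close> is the order of the corner pointing to \<open>B \<inter> D\<close>, \<open>cBD\<close> its crossing number, and \<open>iBD\<close>, \<open>jBD\<close>
  say that it efficiently distinguishes the first and the second pair of profiles. Each of the
  four profiles selects one of two corners.\<close>

lemma corner_choice:
  fixes k x y oBD oBC oAD oAC cBD cBC cAD cAC :: nat
  assumes o: "oBD + oAC = 2 * k" "oBC + oAD = 2 * k"
    and eq: "iBD \<or> jBD \<longrightarrow> oBD = k" "iBC \<or> jBC \<longrightarrow> oBC = k"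
      "iAD \<or> jAD \<longrightarrow> oAD = k" "iAC \<or> jAC \<longrightarrow> oAC = k"
    and sel: "(oBD \<le> k \<longrightarrow> iBD) \<or> (oBC \<le> k \<longrightarrow> iBC)" "(oAD \<le> k \<longrightarrow> iAD) \<or> (oAC \<le> k \<longrightarrow> iAC)"
      "(oBD \<le> k \<longrightarrow> jBD) \<or> (oAD \<le> k \<longrightarrow> jAD)" "(oBC \<le> k \<longrightarrow> jBC) \<or> (oAC \<le> k \<longrightarrow> jAC)"
    and c: "(iBD \<or> jBD) \<and> (iAC \<or> jAC) \<longrightarrow> cBD + cAC < x + y"
      "(iBC \<or> jBC) \<and> (iAD \<or> jAD) \<longrightarrow> cBC + cAD < x + y"
  shows "iBD \<and> cBD < x \<or> iBC \<and> cBC < x \<or> iAD \<and> cAD < x \<or> iAC \<and> cAC < x \<or>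
    jBD \<and> cBD < y \<or> jBC \<and> cBC < y \<or> jAD \<and> cAD < y \<or> jAC \<and> cAC < y"
proof (rule ccontr)
  assume "\<not> ?thesis"
  then have n: "iBD \<Longrightarrow> x \<le> cBD" "iBC \<Longrightarrow> x \<le> cBC" "iAD \<Longrightarrow> x \<le> cAD" "iAC \<Longrightarrow> x \<le> cAC"
    "jBD \<Longrightarrow> y \<le> cBD" "jBC \<Longrightarrow> y \<le> cBC" "jAD \<Longrightarrow> y \<le> cAD" "jAC \<Longrightarrow> y \<le> cAC"
    by (simp_all add: not_less)
  have small: "oBD \<le> k \<or> oAC \<le> k" "oBC \<le> k \<or> oAD \<le> k" using o by linarith+
  \<comment> \<open>An efficient corner has order exactly \<open>k\<close>, hence so does the
    opposite one, which is then eligible as well.\<close>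
  have opp: "iBD \<or> jBD \<Longrightarrow> oAC \<le> k" "iAC \<or> jAC \<Longrightarrow> oBD \<le> k"
    "iBC \<or> jBC \<Longrightarrow> oAD \<le> k" "iAD \<or> jAD \<Longrightarrow> oBC \<le> k"
    using o eq by linarith+
  have le: "iBD \<or> jBD \<Longrightarrow> oBD \<le> k" "iAC \<or> jAC \<Longrightarrow> oAC \<le> k"
    "iBC \<or> jBC \<Longrightarrow> oBC \<le> k" "iAD \<or> jAD \<Longrightarrow> oAD \<le> k"
    using eq by simp_all
  \<comment> \<open>Opposite corners serving different pairs would have crossing numbers at least
    \<open>x\<close> and \<open>y\<close>, against the bound in \<open>c\<close>. If both serve the
    same pair, the bound gives \<open>x < y\<close> for the first pair and \<open>y < x\<close> for
    the second, so the two pairs cannot both occur in this way.\<close>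
  have mixed: "\<not> (iBD \<and> jAC)" "\<not> (jBD \<and> iAC)" "\<not> (iBC \<and> jAD)" "\<not> (jBC \<and> iAD)"
    using n c by fastforce+
  have ii: "iBD \<Longrightarrow> iAC \<Longrightarrow> x < y" "iBC \<Longrightarrow> iAD \<Longrightarrow> x < y"
    using n(1,4) c(1) n(2,3) c(2) by simp_all
  have jj: "jBD \<Longrightarrow> jAC \<Longrightarrow> \<not> x < y" "jBC \<Longrightarrow> jAD \<Longrightarrow> \<not> x < y"
    using n(5,8) c(1) n(6,7) c(2) by simp_all
  show False
    using sel small opp le mixed ii jj by blast
qed

lemma corner_equal:
  fixes \<T> :: "'a set set"
  defines "cr \<equiv> \<lambda>Z. card {S \<in> \<T>. card S = card Z \<and> cross Z S}"
  assumes t: "\<And>S. S \<in> \<T> \<Longrightarrow> tight S"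
    and good: "good P" "good P'" "good Q" "good Q'"
    and e: "eff P P' A B" and f: "eff Q Q' C D" and XY: "A \<inter> B \<in> \<T>" "C \<inter> D \<in> \<T>"
    and card: "card (A \<inter> B) = card (C \<inter> D)" and cross: "cross (A \<inter> B) (C \<inter> D)"
  shows "\<exists>Z \<subseteq> (A \<inter> B) \<union> (C \<inter> D). Z \<in> separators P P' \<and> cr Z < cr (A \<inter> B) \<or>
    Z \<in> separators Q Q' \<and> cr Z < cr (C \<inter> D)"
proof -
  define k where "k = card (A \<inter> B)"
  have r: "rprofile P" "rprofile P'" "rprofile Q" "rprofile Q'" using good unfolding good_def by blast+
  note sAB = rprofileD(1,2)[OF r(1) effD(1)[OF e]]
  note sCD = rprofileD(1,2)[OF r(3) effD(1)[OF f]]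
  note sDC = rprofileD(1,2)[OF r(4) effD(2)[OF f]]
  have kk: "card (A \<inter> B) = k" "card (B \<inter> A) = k" "card (C \<inter> D) = k" "card (D \<inter> C) = k"
    using card k_def by (simp_all add: Int_commute)
  define ok where "ok G H \<longleftrightarrow> (\<exists>R R'. good R \<and> good R' \<and> eff R R' G H)" for G H
  have ok: "tight (G \<inter> H)" "\<And>S. tight S \<Longrightarrow> S \<subseteq> G \<or> S \<subseteq> H \<Longrightarrow> \<not> cross S (G \<inter> H)" if "ok G H" for G H
    using that eff_tight eff_side_not_cross unfolding ok_def by blast+
  let ?iBD = "eff P P' (A \<union> C) (B \<inter> D)" and ?jBD = "eff Q Q' (A \<union> C) (B \<inter> D)"
  \<comment> \<open>The first side of each corner is always the one formed from \<open>A\<close>, so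
    \<open>P\<close> and \<open>P'\<close> keep their order. Where \<open>D\<close> is used with it,
    \<open>Q\<close> and \<open>Q'\<close> change places, because \<open>(D, C)\<close> belongs to
    \<open>Q'\<close>.\<close>
  let ?iBC = "eff P P' (A \<union> D) (B \<inter> C)" and ?jBC = "eff Q' Q (A \<union> D) (B \<inter> C)"
  let ?iAD = "eff P P' (A \<inter> D) (B \<union> C)" and ?jAD = "eff Q' Q (A \<inter> D) (B \<union> C)"
  let ?iAC = "eff P P' (A \<inter> C) (B \<union> D)" and ?jAC = "eff Q Q' (A \<inter> C) (B \<union> D)"
  have okI: "ok G H" if "eff P P' G H \<or> eff Q Q' G H \<or> eff Q' Q G H" for G H
    using that good unfolding ok_def by blast
  have effk: "card (G \<inter> H) = k" if "eff P P' G H \<or> eff Q Q' G H \<or> eff Q' Q G H" for G H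
    using that eff_card_eq[OF e, of G H] eff_card_eq[OF f, of G H] eff_card_eq[OF eff_swap[OF f], of G H] kk
    by auto
  let ?oBD = "card ((A \<union> C) \<inter> (B \<inter> D))" and ?oAC = "card ((A \<inter> C) \<inter> (B \<union> D))"
    and ?oBC = "card ((A \<union> D) \<inter> (B \<inter> C))" and ?oAD = "card ((A \<inter> D) \<inter> (B \<union> C))"
  have sums: "?oBD + ?oAC = 2 * k" "?oBC + ?oAD = 2 * k"
    using corner_card[OF sAB(1) sCD(1) sAB(2) sCD(2)] corner_card[OF sAB(1) sDC(1) sAB(2) sDC(2)] kk
    by simp_all
  have orient: "(C, D) \<in> P \<or> (D, C) \<in> P" "(C, D) \<in> P' \<or> (D, C) \<in> P'"
    "(A, B) \<in> Q \<or> (B, A) \<in> Q" "(A, B) \<in> Q' \<or> (B, A) \<in> Q'"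
    using rprofile_orient[OF r(1) effD(1)[OF e] sCD] rprofile_orient[OF r(2) effD(2)[OF e] sCD]
      rprofile_orient[OF r(3) effD(1)[OF f] sAB] rprofile_orient[OF r(4) effD(2)[OF f] sAB] kk by simp_all
  have comm: "(B \<union> C) \<inter> (A \<inter> D) = (A \<inter> D) \<inter> (B \<union> C)" "(B \<union> D) \<inter> (A \<inter> C) = (A \<inter> C) \<inter> (B \<union> D)"
    "C \<union> A = A \<union> C" "D \<inter> B = B \<inter> D" "C \<union> B = B \<union> C" "D \<inter> A = A \<inter> D"
    "D \<union> A = A \<union> D" "C \<inter> B = B \<inter> C" "D \<union> B = B \<union> D" "C \<inter> A = A \<inter> C" by blast+
  \<comment> \<open>\<open>P\<close> points to \<open>B\<close>; its orientation of
    \<open>{C, D}\<close> decides which of the two corners on that side it selects. The other three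
    profiles behave likewise.\<close>
  have sP: "(?oBD \<le> k \<longrightarrow> ?iBD) \<or> (?oBC \<le> k \<longrightarrow> ?iBC)"
    using orient(1) eff_corner[OF r(1,2) e, of C D] eff_corner[OF r(1,2) e, of D C]
    unfolding kk by blast
  have sP': "(?oAD \<le> k \<longrightarrow> ?iAD) \<or> (?oAC \<le> k \<longrightarrow> ?iAC)"
    using orient(2) eff_corner[OF r(2,1) eff_swap[OF e], of C D] eff_corner[OF r(2,1) eff_swap[OF e], of D C]
      eff_swap[of P' P]
    unfolding kk comm by blast
  have sQ: "(?oBD \<le> k \<longrightarrow> ?jBD) \<or> (?oAD \<le> k \<longrightarrow> ?jAD)"
    using orient(3) eff_corner[OF r(3,4) f, of A B] eff_corner[OF r(3,4) f, of B A] eff_swap[of Q Q']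
    unfolding kk comm by blast
  have sQ': "(?oBC \<le> k \<longrightarrow> ?jBC) \<or> (?oAC \<le> k \<longrightarrow> ?jAC)"
    using orient(4) eff_corner[OF r(4,3) eff_swap[OF f], of A B] eff_corner[OF r(4,3) eff_swap[OF f], of B A]
      eff_swap[of Q' Q]
    unfolding kk comm by blast
  have c1: "cr ((A \<union> C) \<inter> (B \<inter> D)) + cr ((A \<inter> C) \<inter> (B \<union> D)) < cr (A \<inter> B) + cr (C \<inter> D)"
    if "(?iBD \<or> ?jBD) \<and> (?iAC \<or> ?jAC)"
  proof -
    have o: "ok (A \<union> C) (B \<inter> D)" "ok (A \<inter> C) (B \<union> D)" using that okI by blast+
    have k: "?oBD = k" "?oAC = k" using that effk by blast+
    show ?thesis
      unfolding cr_def
      by (rule opposite_corners[OF t sAB(1) sCD(1) XY cross ok(1)[OF o(1)] ok(1)[OF o(2)] kk(1,3) k])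
        (use ok(2)[OF o(1)] ok(2)[OF o(2)] in blast)+
  qed
  have c2: "cr ((A \<union> D) \<inter> (B \<inter> C)) + cr ((A \<inter> D) \<inter> (B \<union> C)) < cr (A \<inter> B) + cr (C \<inter> D)"
    if "(?iBC \<or> ?jBC) \<and> (?iAD \<or> ?jAD)"
  proof -
    have o: "ok (A \<union> D) (B \<inter> C)" "ok (A \<inter> D) (B \<union> C)" using that okI by blast+
    have k: "?oBC = k" "?oAD = k" using that effk by blast+
    have XY': "D \<inter> C \<in> \<T>" "cross (A \<inter> B) (D \<inter> C)" using XY cross by (simp_all only: Int_commute)
    have "cr ((A \<union> D) \<inter> (B \<inter> C)) + cr ((A \<inter> D) \<inter> (B \<union> C)) < cr (A \<inter> B) + cr (D \<inter> C)"
      unfolding cr_def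
      by (rule opposite_corners[OF t sAB(1) sDC(1) XY(1) XY' ok(1)[OF o(1)] ok(1)[OF o(2)] kk(1,4) k])
        (use ok(2)[OF o(1)] ok(2)[OF o(2)] in blast)+
    then show ?thesis by (simp only: Int_commute)
  qed
  have sub: "(A \<union> C) \<inter> (B \<inter> D) \<subseteq> (A \<inter> B) \<union> (C \<inter> D)" "(A \<inter> C) \<inter> (B \<union> D) \<subseteq> (A \<inter> B) \<union> (C \<inter> D)"
    "(A \<union> D) \<inter> (B \<inter> C) \<subseteq> (A \<inter> B) \<union> (C \<inter> D)" "(A \<inter> D) \<inter> (B \<union> C) \<subseteq> (A \<inter> B) \<union> (C \<inter> D)" by blast+
  have w: ?thesis if GH: "G \<inter> H \<subseteq> (A \<inter> B) \<union> (C \<inter> D)"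
    "eff P P' G H \<and> cr (G \<inter> H) < cr (A \<inter> B) \<or> (eff Q Q' G H \<or> eff Q' Q G H) \<and> cr (G \<inter> H) < cr (C \<inter> D)" for G H
  proof (intro exI[of _ "G \<inter> H"] conjI)
    show "G \<inter> H \<in> separators P P' \<and> cr (G \<inter> H) < cr (A \<inter> B) \<or>
        G \<inter> H \<in> separators Q Q' \<and> cr (G \<inter> H) < cr (C \<inter> D)"
      using GH(2) separatorsI[OF _ refl, of P P' G H] separatorsI[OF _ refl, of Q Q' G H]
        separatorsI[OF _ refl, of Q' Q G H] separators_swap[of Q Q'] by argo
  qed (rule GH(1))
  have eqk: "?iBD \<or> ?jBD \<longrightarrow> ?oBD = k" "?iBC \<or> ?jBC \<longrightarrow> ?oBC = k"
    "?iAD \<or> ?jAD \<longrightarrow> ?oAD = k" "?iAC \<or> ?jAC \<longrightarrow> ?oAC = k"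
    using effk by blast+
  have c: "(?iBD \<or> ?jBD) \<and> (?iAC \<or> ?jAC) \<longrightarrow>
      cr ((A \<union> C) \<inter> (B \<inter> D)) + cr ((A \<inter> C) \<inter> (B \<union> D)) < cr (A \<inter> B) + cr (C \<inter> D)"
    "(?iBC \<or> ?jBC) \<and> (?iAD \<or> ?jAD) \<longrightarrow>
      cr ((A \<union> D) \<inter> (B \<inter> C)) + cr ((A \<inter> D) \<inter> (B \<union> C)) < cr (A \<inter> B) + cr (C \<inter> D)"
    using c1 c2 by (iprover)+
  from corner_choice[OF sums eqk sP sP' sQ sQ' c] show ?thesis
    using w[OF sub(1)] w[OF sub(2)] w[OF sub(3)] w[OF sub(4)] by argo
qed

text \<open>Having smaller order, \<open>{A, B}\<close> cannot distinguish \<open>Q\<close> from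
  \<open>Q'\<close>, so both orient it alike and \<open>corner_less\<close> applies. The new corner
  does not cross \<open>A \<inter> B\<close>, which lies on one of its sides.\<close>

lemma corner_less_ex:
  assumes good: "good P" "good P'" "good Q" "good Q'"
    and e: "eff P P' A B" and f: "eff Q Q' C D" and less: "card (A \<inter> B) < card (C \<inter> D)"
  shows "\<exists>Z \<subseteq> (A \<inter> B) \<union> (C \<inter> D). Z \<in> separators Q Q' \<and> \<not> cross Z (A \<inter> B)"
proof -
  have r: "rprofile P" "rprofile P'" "rprofile Q" "rprofile Q'" using good unfolding good_def by blast+
  note sAB = rprofileD(1,2)[OF r(1) effD(1)[OF e]]
  \<comment> \<open>\<open>(G, H)\<close> stands for whichever of \<open>(A, B)\<close> and
    \<open>(B, A)\<close> belongs to both \<open>Q\<close> and \<open>Q'\<close>; in the second case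
    \<open>(R, R')\<close> is \<open>(P', P)\<close>.\<close>
  have fin: ?thesis if e: "eff R R' G H" and R: "good R" "good R'" and GH: "G \<inter> H = A \<inter> B"
    and o: "(G, H) \<in> Q" "(G, H) \<in> Q'" for R R' G H
  proof -
    have tGH: "tight (G \<inter> H)" using eff_tight[OF R e] .
    have "eff Q Q' (C \<union> G) (D \<inter> H) \<or> eff Q' Q (D \<union> G) (C \<inter> H)"
      using corner_less[OF R good(3,4) e f _ o] less GH by simp
    then show ?thesis
    proof
      assume *: "eff Q Q' (C \<union> G) (D \<inter> H)"
      have "\<not> cross (G \<inter> H) ((C \<union> G) \<inter> (D \<inter> H))"
        by (rule eff_side_not_cross[OF good(3,4) * tGH]) blast
      moreover have "(C \<union> G) \<inter> (D \<inter> H) \<subseteq> (A \<inter> B) \<union> (C \<inter> D)" using GH by blast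
      ultimately show ?thesis using separatorsI[OF * refl] cross_sym GH by metis
    next
      assume *: "eff Q' Q (D \<union> G) (C \<inter> H)"
      have "\<not> cross (G \<inter> H) ((D \<union> G) \<inter> (C \<inter> H))"
        by (rule eff_side_not_cross[OF good(4,3) * tGH]) blast
      moreover have "(D \<union> G) \<inter> (C \<inter> H) \<subseteq> (A \<inter> B) \<union> (C \<inter> D)" using GH by blast
      ultimately show ?thesis using separatorsI[OF * refl] cross_sym GH separators_swap by metis
    qed
  qed
  have "(A, B) \<in> Q \<or> (B, A) \<in> Q" "(A, B) \<in> Q' \<or> (B, A) \<in> Q'"
    using rprofile_orient[OF r(3) effD(1)[OF f] sAB] rprofile_orient[OF r(4) effD(2)[OF f] sAB] less
    by (simp_all add: Int_commute)
  moreover have "\<not> ((A, B) \<in> Q \<and> (B, A) \<in> Q')" using effD(3)[OF f, of A B] less by auto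
  moreover have "\<not> ((B, A) \<in> Q \<and> (A, B) \<in> Q')" using effD(3)[OF f, of B A] less by (auto simp: Int_commute)
  ultimately consider "(A, B) \<in> Q" "(A, B) \<in> Q'" | "(B, A) \<in> Q" "(B, A) \<in> Q'" by blast
  then show ?thesis
    using fin[OF e good(1,2) refl] fin[OF eff_swap[OF e] good(2,1) Int_commute] by cases
qed

lemma noncrossing_separators:
  assumes good: "\<And>P. P \<in> \<P> \<Longrightarrow> good P"
  shows "\<exists>N. (\<forall>X\<in>N. tight X) \<and> (\<forall>X\<in>N. \<forall>Y\<in>N. \<not> cross X Y) \<and>
    (\<forall>P\<in>\<P>. \<forall>P'\<in>\<P>. separators P P' \<noteq> {} \<longrightarrow> separators P P' \<inter> N \<noteq> {})"
proof -
  define \<A> where "\<A> = {separators P P' | P P'. P \<in> \<P> \<and> P' \<in> \<P> \<and> separators P P' \<noteq> {}}"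
  have t: "tight X" if "X \<in> \<Union>\<A>" for X
    using that good separators_tight unfolding \<A>_def by blast
  have corner: "\<not> cross S Z" if "X \<in> \<Union>\<A>" "Y \<in> \<Union>\<A>" "S \<in> \<Union>\<A>" "Z \<in> \<Union>\<A>" "cross X Y"
    "\<not> cross S X" "\<not> cross S Y" "Z \<subseteq> X \<union> Y" for S X Y Z
    using corner_not_cross[OF t t t t] that by blast
  have "\<exists>N\<subseteq>\<Union>\<A>. (\<forall>X\<in>N. \<forall>Y\<in>N. \<not> cross X Y) \<and> (\<forall>A\<in>\<A>. A \<inter> N \<noteq> {})"
  proof (rule thin_splinter[where sz = card])
    show "cross Y X" if "cross X Y" for X Y using cross_sym[OF that] .
    show "A \<noteq> {}" if "A \<in> \<A>" for A using that unfolding \<A>_def by blast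
    show "card X = card Y" if "A \<in> \<A>" "X \<in> A" "Y \<in> A" for A X Y
      using that separators_card unfolding \<A>_def by blast
    show "finite {Y \<in> \<Union>\<A>. card Y \<le> card X \<and> cross X Y}" if "X \<in> \<Union>\<A>" for X
      by (rule finite_subset[OF _ finite_cross[OF t[OF that], of "card X"]]) (use t in blast)
  next
    fix \<B> \<C> X Y
    assume *: "\<B> \<in> \<A>" "\<C> \<in> \<A>" "X \<in> \<B>" "Y \<in> \<C>" "card X < card Y" "cross X Y"
    obtain P P' Q Q' where P: "P \<in> \<P>" "P' \<in> \<P>" "\<B> = separators P P'"
      and Q: "Q \<in> \<P>" "Q' \<in> \<P>" "\<C> = separators Q Q'" using *(1,2) unfolding \<A>_def by blast
    obtain A B C D where "X = A \<inter> B" "eff P P' A B" "Y = C \<inter> D" "eff Q Q' C D"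
      using *(3,4) P(3) Q(3) unfolding separators_def by blast
    then obtain Z where Z: "Z \<subseteq> X \<union> Y" "Z \<in> \<C>" "\<not> cross Z X"
      using corner_less_ex[OF good[OF P(1)] good[OF P(2)] good[OF Q(1)] good[OF Q(2)], of A B C D] *(5) Q(3)
      by blast
    have "\<forall>S\<in>\<Union>\<A>. \<not> cross S X \<and> \<not> cross S Y \<longrightarrow> \<not> cross S Z"
      using corner[of X Y _ Z] * Z(1,2) by blast
    then show "\<exists>Z\<in>\<C>. \<not> cross Z X \<and> (\<forall>S\<in>\<Union>\<A>. \<not> cross S X \<and> \<not> cross S Y \<longrightarrow> \<not> cross S Z)"
      using Z by blast
  next
    fix \<B> \<C> X Y
    assume *: "\<B> \<in> \<A>" "\<C> \<in> \<A>" "X \<in> \<B>" "Y \<in> \<C>" "card X = card Y" "cross X Y"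
    define cr where "cr Z = card {S \<in> \<Union>\<A>. card S = card Z \<and> cross Z S}" for Z
    obtain P P' Q Q' where P: "P \<in> \<P>" "P' \<in> \<P>" "\<B> = separators P P'"
      and Q: "Q \<in> \<P>" "Q' \<in> \<P>" "\<C> = separators Q Q'" using *(1,2) unfolding \<A>_def by blast
    obtain A B C D where X: "X = A \<inter> B" "eff P P' A B" and Y: "Y = C \<inter> D" "eff Q Q' C D"
      using *(3,4) P(3) Q(3) unfolding separators_def by blast
    have XA: "A \<inter> B \<in> \<Union>\<A>" "C \<inter> D \<in> \<Union>\<A>" using *(1-4) X(1) Y(1) by blast+
    obtain Z where Z: "Z \<subseteq> X \<union> Y" "Z \<in> \<B> \<and> cr Z < cr X \<or> Z \<in> \<C> \<and> cr Z < cr Y"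
      using corner_equal[OF t good[OF P(1)] good[OF P(2)] good[OF Q(1)] good[OF Q(2)] X(2) Y(2) XA] *(5,6)
      unfolding P(3) Q(3) X(1) Y(1) cr_def by blast
    have "\<forall>S\<in>\<Union>\<A>. \<not> cross S X \<and> \<not> cross S Y \<longrightarrow> \<not> cross S Z"
      using corner[of X Y _ Z] * Z by blast
    then show "\<exists>Z. (Z \<in> \<B> \<and> card {S \<in> \<Union>\<A>. card S = card Z \<and> cross Z S} < card {S \<in> \<Union>\<A>. card S = card X \<and> cross X S} \<or>
        Z \<in> \<C> \<and> card {S \<in> \<Union>\<A>. card S = card Z \<and> cross Z S} < card {S \<in> \<Union>\<A>. card S = card Y \<and> cross Y S}) \<and>
        (\<forall>S\<in>\<Union>\<A>. \<not> cross S X \<and> \<not> cross S Y \<longrightarrow> \<not> cross S Z)"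
      using Z(2) unfolding cr_def by blast
  qed
  then obtain N where N: "N \<subseteq> \<Union>\<A>" "\<forall>X\<in>N. \<forall>Y\<in>N. \<not> cross X Y" "\<forall>A\<in>\<A>. A \<inter> N \<noteq> {}" by blast
  have "separators P P' \<inter> N \<noteq> {}" if "P \<in> \<P>" "P' \<in> \<P>" "separators P P' \<noteq> {}" for P P'
    using that N(3) unfolding \<A>_def by blast
  moreover have "\<forall>X\<in>N. tight X" using N(1) t by blast
  ultimately show ?thesis using N(2) by (intro exI[of _ N] conjI ballI impI) simp_all
qed

section \<open>From separators to nested separations\<close>

lemma full_separation:
  assumes "full X C" "X \<subseteq> V"
  shows "separation V E (V - C, C \<union> X)" "(V - C) \<inter> (C \<union> X) = X"
proof -
  have "component X w \<subseteq> C" if "w \<in> C" for w using fullD(4)[OF assms(1) that] by simp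
  moreover have "C \<subseteq> V - X" using fullD(1,2)[OF assms(1)] by blast
  ultimately show "separation V E (V - C, C \<union> X)" "(V - C) \<inter> (C \<union> X) = X"
    using separation_union_components[OF assms(2)] by blast+
qed

lemma nestedI: "sep_le (A, B) (C, D) \<Longrightarrow> nested {A, B} {C, D}"
  unfolding nested_def by blast

lemma nested_sym:
  assumes "nested r s"
  shows "nested s r"
proof -
  obtain A B C D where "r = {B, A}" "s = {D, C}" "sep_le (A, B) (C, D)"
    using assms unfolding nested_def by (metis insert_commute)
  then show ?thesis using nestedI[of D C B A] by simp
qed

text \<open>\<open>C\<close> and \<open>X - Y\<close> lie in one component of \<open>G - Y\<close>.
  If that is \<open>D\<close>, then \<open>C \<union> X\<close> is contained in
  \<open>D \<union> Y\<close>; otherwise it is disjoint from \<open>D\<close>. So nestedness is in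
  doubt only when \<open>C\<close> meets \<open>Y\<close> and \<open>D\<close> meets
  \<open>X\<close>.\<close>

lemma full_avoid_nested:
  assumes C: "full X C" and D: "full Y D" and V: "X \<subseteq> V" "Y \<subseteq> V" and avoid: "C \<inter> Y = {}"
  shows "nested {V - C, C \<union> X} {V - D, D \<union> Y}"
proof -
  obtain c where c: "c \<in> C" using fullD(3)[OF C] by blast
  have C_eq: "component X c = C" using fullD(4)[OF C c] by simp
  have sub: "C \<subseteq> component Y c" using component_avoid[of X c Y] avoid unfolding C_eq by simp
  have XY: "x \<in> component Y c" if "x \<in> X - Y" for x using full_attach[OF C avoid that c] .
  show ?thesis
  proof (cases "c \<in> D")
    case True
    then have D_eq: "component Y c = D" using fullD(4)[OF D, of c] by simp
    have "C \<union> X \<subseteq> D \<union> Y" "V - D \<subseteq> V - C" using sub XY unfolding D_eq by blast+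
    then have "nested {C \<union> X, V - C} {D \<union> Y, V - D}" by (intro nestedI) simp
    then show ?thesis
      unfolding insert_commute[of "V - C" "C \<union> X"] insert_commute[of "V - D" "D \<union> Y"] .
  next
    case False
    have "component Y c \<inter> D = {}"
    proof (rule ccontr)
      assume "component Y c \<inter> D \<noteq> {}"
      then obtain d where d: "d \<in> component Y c" "d \<in> D" by blast
      have "c \<in> component Y d" using component_sym[OF d(1)] .
      then show False using fullD(4)[OF D d(2)] False by simp
    qed
    then have "C \<union> X \<subseteq> V - D" "D \<union> Y \<subseteq> V - C"
      using sub XY V fullD(1)[OF C] fullD(1,2)[OF D] avoid by blast+
    then have "nested {C \<union> X, V - C} {V - D, D \<union> Y}" by (intro nestedI) simp
    then show ?thesis unfolding insert_commute[of "V - C" "C \<union> X"] .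
  qed
qed

text \<open>Two full components \<open>C\<close> of \<open>G - X\<close> and \<open>D\<close> of \<open>G - Y\<close> that contain the rest of the other separator
  need not give nested separations, as there may be components attached to \<open>X \<inter> Y\<close> only. So
  one full component is left out for every separator, namely the one containing the least vertex
  of all full components in a fixed well-ordering.\<close>

lemma nested_separations:
  assumes t: "\<And>X. X \<in> N \<Longrightarrow> tight X" and nc: "\<And>X Y. X \<in> N \<Longrightarrow> Y \<in> N \<Longrightarrow> \<not> cross X Y"
  shows "\<exists>M \<subseteq> unoriented_separations V E. nested_set M \<and>
    (\<forall>X\<in>N. \<forall>C D. full X C \<and> full X D \<and> C \<noteq> D \<longrightarrow> {V - C, C \<union> X} \<in> M \<or> {V - D, D \<union> X} \<in> M)"
proof -
  obtain r :: "'a rel" where r: "well_order_on UNIV r" using well_order_on by blast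
  have XV: "X \<subseteq> V" if "X \<in> N" for X using t[OF that] unfolding tight_def by blast
  define F where "F X = \<Union>{C. full X C}" for X
  have "\<exists>m C. m \<in> C \<and> full X C \<and> (\<forall>z\<in>F X. (m, z) \<in> r)" if X: "X \<in> N" for X
  proof -
    obtain C where "full X C" using t[OF X] unfolding tight_def by blast
    then obtain c where "c \<in> F X" using fullD(3) unfolding F_def by blast
    moreover have wf: "wf (r - Id)" using r unfolding well_order_on_def by blast
    ultimately obtain m where m: "m \<in> F X" "\<And>z. (z, m) \<in> r - Id \<Longrightarrow> z \<notin> F X"
      using wfE_min[of "r - Id" c "F X"] by blast
    have "(m, z) \<in> r" if "z \<in> F X" for z
    proof (cases "z = m")
      case True
      then show ?thesis using r
        unfolding well_order_on_def linear_order_on_def partial_order_on_def preorder_on_def refl_on_def by blast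
    next
      case False
      then have "(m, z) \<in> r \<or> (z, m) \<in> r" using r
        unfolding well_order_on_def linear_order_on_def total_on_def by blast
      then show ?thesis using m(2)[of z] that False by blast
    qed
    then show ?thesis using m(1) unfolding F_def by blast
  qed
  then obtain m C0 where C0: "\<And>X. X \<in> N \<Longrightarrow> m X \<in> C0 X" "\<And>X. X \<in> N \<Longrightarrow> full X (C0 X)"
    and least: "\<And>X z. X \<in> N \<Longrightarrow> z \<in> F X \<Longrightarrow> (m X, z) \<in> r" by metis
  have antisym: "a = b" if "(a, b) \<in> r" "(b, a) \<in> r" for a b
    using r that unfolding well_order_on_def linear_order_on_def partial_order_on_def antisym_def by blast
  define M where "M = {{V - C, C \<union> X} | X C. X \<in> N \<and> full X C \<and> C \<noteq> C0 X}"
  have "{V - C, C \<union> X} \<in> unoriented_separations V E" if "X \<in> N" "full X C" for X C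
    using full_separation(1)[OF that(2) XV[OF that(1)]] unfolding unoriented_separations_def by blast
  then have "M \<subseteq> unoriented_separations V E" unfolding M_def by blast
  moreover have "nested {V - C, C \<union> X} {V - D, D \<union> Y}"
    if X: "X \<in> N" "full X C" "C \<noteq> C0 X" and Y: "Y \<in> N" "full Y D" "D \<noteq> C0 Y" for X C Y D
  proof -
    \<comment> \<open>As \<open>Y'\<close> does not separate \<open>X'\<close>, all of
      \<open>X' - Y'\<close> lies in \<open>D'\<close>. Hence the omitted component
      \<open>C0 Y'\<close> avoids \<open>X'\<close>, and being attached to \<open>Y' - X'\<close> it
      lies in the component \<open>C'\<close> of \<open>G - X'\<close>.\<close>
    have in_full: "C0 Y' \<subseteq> C'"
      if X': "X' \<in> N" "full X' C'" "C' \<inter> Y' \<noteq> {}" and Y': "Y' \<in> N" "full Y' D'" "D' \<noteq> C0 Y'" "D' \<inter> X' \<noteq> {}"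
      for X' C' Y' D'
    proof -
      obtain x where x: "x \<in> D' \<inter> X'" using Y'(4) by blast
      have D': "component Y' x = D'" using fullD(4)[OF Y'(2), of x] x by simp
      have "X' - Y' \<subseteq> D'"
        using nc[OF Y'(1) X'(1)] x fullD(2)[OF Y'(2)] unfolding cross_def separates_def D'[symmetric] by blast
      moreover have "C0 Y' \<inter> D' = {}" "C0 Y' \<inter> Y' = {}"
        using full_disjoint[OF C0(2)[OF Y'(1)] Y'(2)] Y'(3) fullD(2)[OF C0(2)[OF Y'(1)]] by blast+
      ultimately have av: "C0 Y' \<inter> X' = {}" by blast
      obtain y where y: "y \<in> C' \<inter> Y'" using X'(3) by blast
      have C': "component X' y = C'" using fullD(4)[OF X'(2), of y] y by simp
      have "y \<in> Y' - X'" using y fullD(2)[OF X'(2)] by blast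
      then have "y \<in> component X' z" if "z \<in> C0 Y'" for z
        using full_attach[OF C0(2)[OF Y'(1)] av _ that] by blast
      then have "z \<in> component X' y" if "z \<in> C0 Y'" for z using component_sym that by blast
      then show ?thesis unfolding C' by blast
    qed
    have "C \<inter> Y = {} \<or> D \<inter> X = {}"
    proof (rule ccontr)
      assume n: "\<not> ?thesis"
      have "C0 Y \<subseteq> C" "C0 X \<subseteq> D"
        using in_full[OF X(1,2) _ Y] in_full[OF Y(1,2) _ X] n by blast+
      \<comment> \<open>Each of \<open>m X\<close> and \<open>m Y\<close> lies in a full component
        for the other separator, so each precedes the other and they are equal. This common vertex
        lies in \<open>C\<close> and in \<open>C0 X\<close>, which are disjoint.\<close>
      then have mm: "m Y \<in> C" "m X \<in> D" using C0(1) X(1) Y(1) by blast+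
      then have "m Y \<in> F X" "m X \<in> F Y" using X(2) Y(2) unfolding F_def by blast+
      then have "m X = m Y" using least X(1) Y(1) antisym by blast
      then show False using mm(1) C0(1)[OF X(1)] full_disjoint[OF X(2) C0(2)[OF X(1)] X(3)] by auto
    qed
    then show ?thesis
      using full_avoid_nested[OF X(2) Y(2) XV[OF X(1)] XV[OF Y(1)]]
        nested_sym[OF full_avoid_nested[OF Y(2) X(2) XV[OF Y(1)] XV[OF X(1)]]] by blast
  qed
  then have "nested_set M" unfolding nested_set_def M_def by blast
  moreover have "{V - C, C \<union> X} \<in> M \<or> {V - D, D \<union> X} \<in> M"
    if CD: "X \<in> N" "full X C" "full X D" "C \<noteq> D" for X C D
  proof (cases "C = C0 X")
    case True
    then have "D \<noteq> C0 X" using CD(4) by simp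
    then show ?thesis using CD(1,3) unfolding M_def by blast
  next
    case False
    then show ?thesis using CD(1,2) unfolding M_def by blast
  qed
  ultimately show ?thesis by blast
qed

section \<open>Efficient distinguishers cut off single components\<close>

lemma eff_efficiently_distinguishes:
  assumes P: "rprofile P" and e: "eff P P' A B"
  shows "efficiently_distinguishes V E {A, B} P P'"
proof -
  note AB = effD(1)[OF e]
  have "distinguishes V E (A, B) P P'"
    using rprofileD(1)[OF P AB] AB effD(2)[OF e] unfolding distinguishes_def by simp
  moreover have "sep_order (A, B) \<le> sep_order s" if s: "distinguishes V E s P P'" for s
  proof -
    obtain C D where sCD: "s = (C, D)" by fastforce
    have "(C, D) \<in> P \<and> (D, C) \<in> P' \<or> (D, C) \<in> P \<and> (C, D) \<in> P'"
      using s unfolding distinguishes_def sCD by simp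
    then have "card (A \<inter> B) \<le> card (C \<inter> D)" using effD(3)[OF e] by (metis Int_commute)
    then show ?thesis using rprofileD(2)[OF P AB] sCD by simp
  qed
  ultimately show ?thesis unfolding efficiently_distinguishes_def by blast
qed

lemma distinguishable_separators:
  assumes "distinguishable V E P P'"
  shows "separators P P' \<noteq> {}"
proof -
  obtain s where s: "distinguishes V E s P P'" using assms unfolding distinguishable_def by blast
  obtain C D where "s = (C, D)" by fastforce
  then have "\<exists>q. (fst q, snd q) \<in> P \<and> (snd q, fst q) \<in> P'"
    using s unfolding distinguishes_def by (intro exI[of _ "if (C, D) \<in> P \<and> (D, C) \<in> P' then (C, D) else (D, C)"]) auto
  then obtain q where "(fst q, snd q) \<in> P \<and> (snd q, fst q) \<in> P'" by blast
  from ex_has_least_nat[of "\<lambda>q. (fst q, snd q) \<in> P \<and> (snd q, fst q) \<in> P'", OF this, of "\<lambda>q. card (fst q \<inter> snd q)"]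
  obtain q where q: "(fst q, snd q) \<in> P \<and> (snd q, fst q) \<in> P'"
    "\<And>p. (fst p, snd p) \<in> P \<and> (snd p, fst p) \<in> P' \<Longrightarrow> card (fst q \<inter> snd q) \<le> card (fst p \<inter> snd p)" by blast
  have "eff P P' (fst q) (snd q)"
    unfolding eff_def using q(1) q(2)[of "(_, _)"] by simp
  then show ?thesis unfolding separators_def by blast
qed

text \<open>Cutting off \<open>C\<close> keeps the separator \<open>A \<inter> B\<close> and so the
  order; \<open>P'\<close> contains the inverse because it lies below \<open>(B, A)\<close>.\<close>

lemma eff_full_component:
  assumes P: "rprofile P" and P': "rprofile P'" and e: "eff P P' A B"
    and C: "full (A \<inter> B) C" "C \<subseteq> B - A" "(V - C, C \<union> (A \<inter> B)) \<in> P"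
  shows "eff P P' (V - C) (C \<union> (A \<inter> B))"
proof -
  note AB = effD(1)[OF e] and BA = effD(2)[OF e]
  have AV: "A \<subseteq> V" "A \<inter> B \<subseteq> V" using rprofileD(1)[OF P AB] by auto
  note sep = full_separation[OF C(1) AV(2)]
  have int: "(C \<union> (A \<inter> B)) \<inter> (V - C) = A \<inter> B" using sep(2) by blast
  have "(C \<union> (A \<inter> B), V - C) \<in> P'"
  proof (rule rprofile_down[OF P' BA separation_swap[OF sep(1)] _ _ _ BA])
    show "C \<union> (A \<inter> B) \<subseteq> B" "A \<subseteq> V - C" using C(2) AV by blast+
    show "finite ((C \<union> (A \<inter> B)) \<inter> (V - C))" unfolding int by (rule rprofileD(2)[OF P AB])
    show "card ((C \<union> (A \<inter> B)) \<inter> (V - C)) \<le> card (B \<inter> A)" unfolding int by (simp add: Int_commute)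
  qed
  then show ?thesis unfolding eff_def sep(2) using C(3) effD(3)[OF e] by blast
qed

end

theorem theorem4p2:
  fixes V :: "'a set" and E :: "'a set set" and \<P> :: "'a osep set set"
  assumes "connected_graph V E"
    and "\<And>P. P \<in> \<P> \<Longrightarrow> bounded_profile V E P \<and> robust V E P \<and> regular V P"
  shows "\<exists>N \<subseteq> unoriented_separations V E. nested_set N \<and>
    (\<forall>P\<in>\<P>. \<forall>P'\<in>\<P>. distinguishable V E P P' \<longrightarrow>
       (\<exists>r\<in>N. efficiently_distinguishes V E r P P'))"
proof -
  interpret graph_separations V E
    by unfold_locales (use assms(1) in \<open>simp add: connected_graph_def\<close>)
  have good: "good P" if "P \<in> \<P>" for P
    using assms(2)[OF that] unfolding good_def rprofile_def bounded_profile_def by blast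
  obtain N where N: "\<And>X. X \<in> N \<Longrightarrow> tight X" "\<And>X Y. X \<in> N \<Longrightarrow> Y \<in> N \<Longrightarrow> \<not> cross X Y"
    and meet: "\<And>P P'. P \<in> \<P> \<Longrightarrow> P' \<in> \<P> \<Longrightarrow> separators P P' \<noteq> {} \<Longrightarrow> separators P P' \<inter> N \<noteq> {}"
    using noncrossing_separators[OF good] by metis
  obtain M where M: "M \<subseteq> unoriented_separations V E" "nested_set M"
    and full: "\<And>X C D. X \<in> N \<Longrightarrow> full X C \<Longrightarrow> full X D \<Longrightarrow> C \<noteq> D \<Longrightarrow>
      {V - C, C \<union> X} \<in> M \<or> {V - D, D \<union> X} \<in> M"
    using nested_separations[OF N] by metis
  have "\<exists>r\<in>M. efficiently_distinguishes V E r P P'"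
    if PP': "P \<in> \<P>" "P' \<in> \<P>" "distinguishable V E P P'" for P P'
  proof -
    have r: "rprofile P" "bounded_profile V E P" "rprofile P'" "bounded_profile V E P'"
      using good PP' unfolding good_def by blast+
    obtain A B where X: "A \<inter> B \<in> N" and e: "eff P P' A B"
      using meet[OF PP'(1,2) distinguishable_separators[OF PP'(3)]] unfolding separators_def by blast
    obtain C where C: "full (A \<inter> B) C" "C \<subseteq> B - A" "(V - C, C \<union> (A \<inter> B)) \<in> P"
      using eff_full[OF r(1-3) e refl] by blast
    obtain D where D: "full (B \<inter> A) D" "D \<subseteq> A - B" "(V - D, D \<union> (B \<inter> A)) \<in> P'"
      using eff_full[OF r(3,4,1) eff_swap[OF e] refl] by blast
    \<comment> \<open>The same construction from the viewpoint of \<open>P'\<close>, swapped back.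
      Both separations are now efficient for \<open>P\<close> and \<open>P'\<close>, and at least
      one of them belongs to \<open>M\<close>.\<close>
    have eD: "eff P P' (D \<union> (B \<inter> A)) (V - D)"
      by (rule eff_swap[OF eff_full_component[OF r(3,1) eff_swap[OF e] D]])
    have "efficiently_distinguishes V E {V - C, C \<union> (A \<inter> B)} P P'"
      by (rule eff_efficiently_distinguishes[OF r(1) eff_full_component[OF r(1,3) e C]])
    moreover have "efficiently_distinguishes V E {V - D, D \<union> (A \<inter> B)} P P'"
      using eff_efficiently_distinguishes[OF r(1) eD] by (simp add: insert_commute Int_commute)
    moreover have "C \<noteq> D" using C(2) D(2) fullD(3)[OF C(1)] by blast
    moreover have "full (A \<inter> B) D" using D(1) by (simp only: Int_commute)
    ultimately show ?thesis using full[OF X C(1)] by blast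
  qed
  then show ?thesis using M by blast
qed

end
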